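(* Let $\mathcal{K}$ be a cofinal Erdős–Rado class witnessed by $f$, and let $(\mathbb{K},\prec_{\mathbb{K}})$ be a PC pair with $\tau=\tau(\mathbb{K})$ and witnessing language $\tau_1$. Suppose that for every cardinal $\alpha<f(|\tau_1|)$ there are $M_\alpha\in\mathbb{K}$, an $\alpha$-big $I_\alpha\in\mathcal{K}$, and an injection $f_\alpha:I_\alpha\to M_\alpha$. Then there is $\Phi\in\Upsilon^{\mathcal{K}}_{|\tau_1|}[\mathbb{K}]$ such that, for every $p\in S^{inc}_{\mathcal{K}}$, there are cofinally many $\alpha<f(|\tau_1|)$ for which there are $i_1<\dots<i_n\in I_\alpha$ realizing $p$ with $$tp_\tau\left(f_\alpha(i_1),\dots,f_\alpha(i_n);M_\alpha\right)=\Phi(p)\restriction\tau .$$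
   Context: **Abstract classes and types.** An abstract class $\mathcal{K}$ is a class of structures in a fixed language $\tau(\mathcal{K})$ with a partial order $\leq_{\mathcal{K}}$ contained in the substructure relation, such that membership and $\leq_{\mathcal{K}}$ respect isomorphism. A $\mathcal{K}$-embedding $f:M\to N$ is an injection preserving and reflecting atomic formulas with $f(M)\leq_{\mathcal{K}}N$. $\mathcal{K}$ is ordered if $\tau(\mathcal{K})$ has a distinguished binary relation $<$ that is a total order in every member. Finite tuples $\mathbf{a}_1\in I_1$, $\mathbf{a}_2\in I_2$ have the same $\mathcal{K}$-type iff there are $J_1,\dots,J_n, I_1^*,\dots,I_{n+1}^*\in\mathcal{K}$, tuples $\mathbf{b}_\ell\in I^*_\ell$ and $\mathcal{K}$-embeddings $f_\ell:I^*_{\ell+1}\to J_\ell$ with $I_1^*=I_1$, $I_{n+1}^*=I_2$, $\mathbf{b}_1=\mathbf{a}_1$, $\mathbf{b}_{n+1}=\mathbf{a}_2$, $I_\ell^*\leq_{\mathcal{K}}J_\ell$, and $\mathbf{b}_\ell=f_\ell(\mathbf{b}_{\ell+1})$. The equivalence class is $tp_{\mathcal{K}}(\mathbf{a};I)$. $S^n_{\mathcal{K}}$ is the set of $\mathcal{K}$-types of $n$-tuples, $S^{inc,n}_{\mathcal{K}}$ those of tuples $a_1<\dots<a_n$, $S_{\mathcal{K}}=\bigcup_n S^n_{\mathcal{K}}$, $S^{inc}_{\mathcal{K}}=\bigcup_n S^{inc,n}_{\mathcal{K}}$. For $p=tp_{\mathcal{K}}(i_1,\dots,i_n;I)$ and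 $s=\{k_1<\dots<k_m\}$ a set of indices, $p^s=tp_{\mathcal{K}}(i_{k_1},\dots,i_{k_m};I)$. For a language $\tau$, $\mathbb{K}^\tau$ is the abstract class of all $\tau$-structures with substructure; $tp_\tau$, $S_\tau$ are types in this class (equivalently, quantifier-free types); $q\restriction\tau$ is the reduct of a type $q$ in a larger language to $\tau$. **Bigness.** A bigness notion for $\mathcal{K}$ is a family of classes $\mathcal{K}_\mu\subseteq\mathcal{K}$ ($\mu$ a cardinal; members are called $\mu$-big) such that each $\mathcal{K}_\mu$ is nonempty; if $\mu_1\leq\mu_2$, $M\leq_{\mathcal{K}}N$ and $M\in\mathcal{K}_{\mu_2}$ then $N\in\mathcal{K}_{\mu_1}$; and every $M\in\mathcal{K}_{\aleph_0}$ realizes every type in $S_{\mathcal{K}}$. **Blueprints.** A blueprint $\Phi$ proper for $\mathcal{K}$ is a function $\Phi:S^{inc}_{\mathcal{K}}\to S_{\tau(\Phi)}$, for some language $\tau(\Phi)$, sending $n$-types to $n$-types with $\Phi(p^s)=\Phi(p)^s$. For $I\in\mathcal{K}$, $EM(I,\Phi)$ is the $\tau(\Phi)$-structure containing $I$, every element of which is a $\tau(\Phi)$-term of a sequence from $I$, with $tp_{\tau(\Phi)}(i_1,\dots,i_n;EM(I,\Phi))=\Phi(tp_{\mathcal{K}}(i_1,\dots,i_n;I))$ for all $i_1<\dots<i_n\in I$; $EM_\tau(I,\Phi)$ is its reduct to $\tau\subseteq\tau(\Phi)$. $\Upsilon^{\mathcal{K}}_\kappa[\mathbb{K}]$ is the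 collection of blueprints $\Phi$ proper for $\mathcal{K}$ with $\tau(\mathbb{K})\subseteq\tau(\Phi)$, $|\tau(\Phi)|\leq\kappa$, such that $EM_{\tau(\mathbb{K})}(I,\Phi)\in\mathbb{K}$ for all $I\in\mathcal{K}$ and $EM_{\tau(\mathbb{K})}(I,\Phi)\prec_{\mathbb{K}}EM_{\tau(\mathbb{K})}(J,\Phi)$ whenever $I\leq_{\mathcal{K}}J\in\mathcal{K}$. **Cofinal Erdős–Rado class.** An ordered abstract class $\mathcal{K}$ with bigness notion is a cofinal Erdős–Rado class witnessed by $f:\mathrm{Card}\to\mathrm{Card}$ iff for every cardinal $\mu$, with $\chi=f(\mu)$, and every language $\sigma$ with $|\sigma|\leq\mu$: whenever for each cardinal $\alpha<\chi$ we have a $\sigma$-structure $M_\alpha$, an $\alpha$-big $I_\alpha\in\mathcal{K}$ and an injection $f_\alpha:I_\alpha\to M_\alpha$, there is a blueprint $\Phi$ proper for $\mathcal{K}$ with $\tau(\Phi)=\sigma$ such that for each $p\in S^{inc}_{\mathcal{K}}$ there are cofinally many $\alpha<\chi$ for which there are $i_1<\dots<i_n\in I_\alpha$ realizing $p$ with $tp_\sigma(f_\alpha(i_1),\dots,f_\alpha(i_n);M_\alpha)=\Phi(p)$. **PC pair.** Let $\mathbb{K}$ be a class of $\tau$-structures and $\prec_{\mathbb{K}}$ a partial order on $\mathbb{K}$. $(\mathbb{K},\prec_{\mathbb{K}})$ is a PC pair with witnessing language $\tau_1\supseteq\tau$ iff there are a first-order $\tau_1$-theory $T_1$ and a collection $\Gamma$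 of (syntactic) $\tau_1$-types such that: a $\tau$-structure $M$ is in $\mathbb{K}$ iff it has an expansion to $\tau_1$ that models $T_1$ and omits all types in $\Gamma$; and for $M,N\in\mathbb{K}$, $M\prec_{\mathbb{K}}N$ iff there are expansions $M_1$ of $M$ and $N_1$ of $N$ to $\tau_1$ that model $T_1$ and omit all types in $\Gamma$ with $M_1\subseteq_{\tau_1}N_1$. *)

theory Defs
  imports Main "HOL-Library.Equipollence" "HOL-Library.Countable_Set"
begin

text \<open>
  A type \<open>'u\<close> plays the role of the set-theoretic universe: sets are the subsets of \<open>'u\<close> of
  cardinality strictly less than that of \<open>'u\<close>, and classes are arbitrary sets of objects built
  from them.  All symbols of languages and all elements of structures are taken from \<open>'u\<close>.
  The universe has infinite sets if and only if \<open>'u\<close> is uncountable; nothing like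
  inaccessibility of its cardinality is needed.
\<close>

section \<open>Cardinals\<close>

definition small_eqpoll :: "'u set \<Rightarrow> 'u set \<Rightarrow> bool" where
  "small_eqpoll A B \<longleftrightarrow> A \<approx> B \<and> A \<prec> (UNIV :: 'u set)"

text \<open>The cardinals strictly below the cardinality of \<open>'u\<close>, finite ones included.\<close>

quotient_type 'u cardinal = "'u set" / partial: small_eqpoll
proof (rule part_equivpI)
  have "\<not> (UNIV :: 'u set) \<lesssim> {}"
    by simp
  then have "({} :: 'u set) \<prec> (UNIV :: 'u set)"
    unfolding lesspoll_def using eqpoll_imp_lepoll eqpoll_sym empty_lepoll by blast
  then show "\<exists>A :: 'u set. small_eqpoll A A"
    unfolding small_eqpoll_def by blast
  show "symp (small_eqpoll :: 'u set \<Rightarrow> _)"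
    unfolding symp_def small_eqpoll_def by (meson eqpoll_sym eq_lesspoll_trans)
  show "transp (small_eqpoll :: 'u set \<Rightarrow> _)"
    unfolding transp_def small_eqpoll_def by (meson eqpoll_trans)
qed

lemma lepoll_linear: "A \<lesssim> B \<or> B \<lesssim> A"
  unfolding lepoll_def using ordLeq_total[OF card_of_Well_order card_of_Well_order]
  by (metis card_of_ordLeq)

instantiation cardinal :: (type) linorder
begin

lift_definition less_eq_cardinal :: "'a cardinal \<Rightarrow> 'a cardinal \<Rightarrow> bool" is "\<lambda>A B. A \<lesssim> B"
  unfolding small_eqpoll_def by (meson eqpoll_sym lepoll_trans1 lepoll_trans2)

definition less_cardinal :: "'a cardinal \<Rightarrow> 'a cardinal \<Rightarrow> bool" where
  "less_cardinal \<kappa> \<mu> \<longleftrightarrow> \<kappa> \<le> \<mu> \<and> \<not> \<mu> \<le> \<kappa>"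

instance
proof
  fix \<kappa> \<mu> \<nu> :: "'a cardinal"
  show "\<kappa> < \<mu> \<longleftrightarrow> \<kappa> \<le> \<mu> \<and> \<not> \<mu> \<le> \<kappa>"
    by (rule less_cardinal_def)
  show "\<kappa> \<le> \<kappa>"
    by transfer simp
  show "\<kappa> \<le> \<mu> \<Longrightarrow> \<mu> \<le> \<nu> \<Longrightarrow> \<kappa> \<le> \<nu>"
    by transfer (rule lepoll_trans)
  show "\<kappa> \<le> \<mu> \<Longrightarrow> \<mu> \<le> \<kappa> \<Longrightarrow> \<kappa> = \<mu>"
    by transfer (auto simp: small_eqpoll_def intro: lepoll_antisym)
  show "\<kappa> \<le> \<mu> \<or> \<mu> \<le> \<kappa>"
    by transfer (rule lepoll_linear)
qed

end

text \<open>Meaningful only if \<open>A\<close> is of smaller cardinality than \<open>'u\<close>.\<close>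

definition cardinality :: "'a set \<Rightarrow> 'u cardinal" where
  "cardinality A = abs_cardinal (SOME B. B \<approx> A)"

definition aleph0 :: "'u cardinal" where
  "aleph0 = cardinality (UNIV :: nat set)"

text \<open>
  The first conjunct is implied by the second one unless \<open>\<chi>\<close> is zero.  It excludes that case,
  for which every class would trivially be an Erd\<odieresis>s-Rado class.
\<close>

definition cofinally_many_below :: "'u cardinal \<Rightarrow> ('u cardinal \<Rightarrow> bool) \<Rightarrow> bool" where
  "cofinally_many_below \<chi> P \<longleftrightarrow>
     (\<exists>\<alpha><\<chi>. P \<alpha>) \<and> (\<forall>\<beta><\<chi>. \<exists>\<alpha>\<ge>\<beta>. \<alpha> < \<chi> \<and> P \<alpha>)"


section \<open>Languages and structures\<close>

text \<open>A symbol is a pair of a name and an arity; constants are function symbols of arity 0.\<close>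

record 'u lang =
  funs :: "('u \<times> nat) set"
  rels :: "('u \<times> nat) set"

definition is_lang :: "'u lang \<Rightarrow> bool" where
  "is_lang L \<longleftrightarrow> funs L \<prec> (UNIV :: 'u set) \<and> rels L \<prec> (UNIV :: 'u set)"

definition sublang :: "'u lang \<Rightarrow> 'u lang \<Rightarrow> bool" where
  "sublang L L' \<longleftrightarrow> funs L \<subseteq> funs L' \<and> rels L \<subseteq> rels L'"

text \<open>
  As usual in model theory, the cardinality of a language is the number of its first-order
  formulas, that is, the number of its symbols plus \<open>\<aleph>\<^sub>0\<close>.
\<close>

definition lang_card :: "'u lang \<Rightarrow> 'u cardinal" where
  "lang_card L = cardinality (funs L <+> rels L <+> (UNIV :: nat set))"

text \<open>The arity of the interpreted symbol is the length of the argument list.\<close>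

record 'u struc =
  carrier :: "'u set"
  fn :: "'u \<Rightarrow> 'u list \<Rightarrow> 'u"
  rl :: "'u \<Rightarrow> 'u list \<Rightarrow> bool"

text \<open>
  Interpretations take default values outside the language and the carrier, so that equality of
  records is equality of structures.
\<close>

definition is_struc :: "'u lang \<Rightarrow> 'u struc \<Rightarrow> bool" where
  "is_struc L M \<longleftrightarrow>
     carrier M \<noteq> {} \<and> carrier M \<prec> (UNIV :: 'u set) \<and>
     (\<forall>g xs. if (g, length xs) \<in> funs L \<and> set xs \<subseteq> carrier M
             then fn M g xs \<in> carrier M else fn M g xs = undefined) \<and>
     (\<forall>r xs. rl M r xs \<longrightarrow> (r, length xs) \<in> rels L \<and> set xs \<subseteq> carrier M)"

definition substruc :: "'u lang \<Rightarrow> 'u struc \<Rightarrow> 'u struc \<Rightarrow> bool" where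
  "substruc L M N \<longleftrightarrow> is_struc L M \<and> is_struc L N \<and> carrier M \<subseteq> carrier N \<and>
     (\<forall>g xs. (g, length xs) \<in> funs L \<longrightarrow> set xs \<subseteq> carrier M \<longrightarrow> fn M g xs = fn N g xs) \<and>
     (\<forall>r xs. (r, length xs) \<in> rels L \<longrightarrow> set xs \<subseteq> carrier M \<longrightarrow> rl M r xs = rl N r xs)"

definition induced :: "'u struc \<Rightarrow> 'u set \<Rightarrow> 'u struc" where
  "induced N A = \<lparr>carrier = A,
     fn = (\<lambda>g xs. if set xs \<subseteq> A then fn N g xs else undefined),
     rl = (\<lambda>r xs. set xs \<subseteq> A \<and> rl N r xs)\<rparr>"

definition reduct :: "'u lang \<Rightarrow> 'u struc \<Rightarrow> 'u struc" where
  "reduct L M = \<lparr>carrier = carrier M,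
     fn = (\<lambda>g xs. if (g, length xs) \<in> funs L then fn M g xs else undefined),
     rl = (\<lambda>r xs. (r, length xs) \<in> rels L \<and> rl M r xs)\<rparr>"

definition expansion :: "'u lang \<Rightarrow> 'u struc \<Rightarrow> 'u lang \<Rightarrow> 'u struc \<Rightarrow> bool" where
  "expansion L M L' M' \<longleftrightarrow> sublang L L' \<and> is_struc L' M' \<and> reduct L M' = M"


section \<open>First-order logic\<close>

datatype 'u trm = Var nat | App 'u "'u trm list"

fun wf_trm :: "'u lang \<Rightarrow> 'u trm \<Rightarrow> bool" where
  "wf_trm L (Var k) \<longleftrightarrow> True"
| "wf_trm L (App g ts) \<longleftrightarrow> (g, length ts) \<in> funs L \<and> (\<forall>t\<in>set ts. wf_trm L t)"

fun fv_trm :: "'u trm \<Rightarrow> nat set" where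
  "fv_trm (Var k) = {k}"
| "fv_trm (App g ts) = (\<Union>t\<in>set ts. fv_trm t)"

fun eval_trm :: "'u struc \<Rightarrow> (nat \<Rightarrow> 'u) \<Rightarrow> 'u trm \<Rightarrow> 'u" where
  "eval_trm M v (Var k) = v k"
| "eval_trm M v (App g ts) = fn M g (map (eval_trm M v) ts)"

datatype 'u fm =
    Eq "'u trm" "'u trm"
  | Rel 'u "'u trm list"
  | Neg "'u fm"
  | And "'u fm" "'u fm"
  | Ex nat "'u fm"

primrec wf_fm :: "'u lang \<Rightarrow> 'u fm \<Rightarrow> bool" where
  "wf_fm L (Eq s t) \<longleftrightarrow> wf_trm L s \<and> wf_trm L t"
| "wf_fm L (Rel r ts) \<longleftrightarrow> (r, length ts) \<in> rels L \<and> (\<forall>t\<in>set ts. wf_trm L t)"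
| "wf_fm L (Neg \<phi>) \<longleftrightarrow> wf_fm L \<phi>"
| "wf_fm L (And \<phi> \<psi>) \<longleftrightarrow> wf_fm L \<phi> \<and> wf_fm L \<psi>"
| "wf_fm L (Ex k \<phi>) \<longleftrightarrow> wf_fm L \<phi>"

primrec fv_fm :: "'u fm \<Rightarrow> nat set" where
  "fv_fm (Eq s t) = fv_trm s \<union> fv_trm t"
| "fv_fm (Rel r ts) = (\<Union>t\<in>set ts. fv_trm t)"
| "fv_fm (Neg \<phi>) = fv_fm \<phi>"
| "fv_fm (And \<phi> \<psi>) = fv_fm \<phi> \<union> fv_fm \<psi>"
| "fv_fm (Ex k \<phi>) = fv_fm \<phi> - {k}"

primrec sat :: "'u struc \<Rightarrow> (nat \<Rightarrow> 'u) \<Rightarrow> 'u fm \<Rightarrow> bool" where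
  "sat M v (Eq s t) \<longleftrightarrow> eval_trm M v s = eval_trm M v t"
| "sat M v (Rel r ts) \<longleftrightarrow> rl M r (map (eval_trm M v) ts)"
| "sat M v (Neg \<phi>) \<longleftrightarrow> \<not> sat M v \<phi>"
| "sat M v (And \<phi> \<psi>) \<longleftrightarrow> sat M v \<phi> \<and> sat M v \<psi>"
| "sat M v (Ex k \<phi>) \<longleftrightarrow> (\<exists>x\<in>carrier M. sat M (v(k := x)) \<phi>)"

primrec atomic :: "'u fm \<Rightarrow> bool" where
  "atomic (Eq s t) \<longleftrightarrow> True"
| "atomic (Rel r ts) \<longleftrightarrow> True"
| "atomic (Neg \<phi>) \<longleftrightarrow> False"
| "atomic (And \<phi> \<psi>) \<longleftrightarrow> False"
| "atomic (Ex k \<phi>) \<longleftrightarrow> False"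

definition is_theory :: "'u lang \<Rightarrow> 'u fm set \<Rightarrow> bool" where
  "is_theory L T \<longleftrightarrow> (\<forall>\<phi>\<in>T. wf_fm L \<phi> \<and> fv_fm \<phi> = {})"

text \<open>Syntactic types are in finitely many variables.\<close>

definition is_syntactic_type :: "'u lang \<Rightarrow> 'u fm set \<Rightarrow> bool" where
  "is_syntactic_type L q \<longleftrightarrow> (\<exists>n. \<forall>\<phi>\<in>q. wf_fm L \<phi> \<and> fv_fm \<phi> \<subseteq> {..<n})"

definition models :: "'u struc \<Rightarrow> 'u fm set \<Rightarrow> bool" where
  "models M T \<longleftrightarrow> (\<forall>\<phi>\<in>T. \<forall>v. range v \<subseteq> carrier M \<longrightarrow> sat M v \<phi>)"

definition omits :: "'u struc \<Rightarrow> 'u fm set \<Rightarrow> bool" where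
  "omits M q \<longleftrightarrow> \<not> (\<exists>v. range v \<subseteq> carrier M \<and> (\<forall>\<phi>\<in>q. sat M v \<phi>))"


section \<open>Abstract classes and types\<close>

record 'u abs_class =
  lang_of :: "'u lang"
  members :: "'u struc set"
  leq :: "('u struc \<times> 'u struc) set"

definition atomic_embedding :: "'u lang \<Rightarrow> ('u \<Rightarrow> 'u) \<Rightarrow> 'u struc \<Rightarrow> 'u struc \<Rightarrow> bool" where
  "atomic_embedding L h M N \<longleftrightarrow>
     inj_on h (carrier M) \<and> h ` carrier M \<subseteq> carrier N \<and>
     (\<forall>\<phi> v. atomic \<phi> \<longrightarrow> wf_fm L \<phi> \<longrightarrow> range v \<subseteq> carrier M \<longrightarrow>
        (sat M v \<phi> \<longleftrightarrow> sat N (h \<circ> v) \<phi>))"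

definition isomorphism :: "'u lang \<Rightarrow> ('u \<Rightarrow> 'u) \<Rightarrow> 'u struc \<Rightarrow> 'u struc \<Rightarrow> bool" where
  "isomorphism L h M N \<longleftrightarrow> is_struc L M \<and> is_struc L N \<and>
     atomic_embedding L h M N \<and> h ` carrier M = carrier N"

definition abstract_class :: "'u abs_class \<Rightarrow> bool" where
  "abstract_class K \<longleftrightarrow>
     is_lang (lang_of K) \<and>
     (\<forall>M\<in>members K. is_struc (lang_of K) M) \<and>
     leq K \<subseteq> members K \<times> members K \<and>
     partial_order_on (members K) (leq K) \<and>
     (\<forall>(M, N)\<in>leq K. substruc (lang_of K) M N) \<and>
     (\<forall>M\<in>members K. \<forall>N h. isomorphism (lang_of K) h M N \<longrightarrow> N \<in> members K) \<and>
     (\<forall>(M, N)\<in>leq K. \<forall>N' h. isomorphism (lang_of K) h N N' \<longrightarrow>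
        (induced N' (h ` carrier M), N') \<in> leq K)"

definition K_embedding :: "'u abs_class \<Rightarrow> ('u \<Rightarrow> 'u) \<Rightarrow> 'u struc \<Rightarrow> 'u struc \<Rightarrow> bool" where
  "K_embedding K h M N \<longleftrightarrow>
     atomic_embedding (lang_of K) h M N \<and> (induced N (h ` carrier M), N) \<in> leq K"

definition ordered_class :: "'u abs_class \<Rightarrow> 'u \<Rightarrow> bool" where
  "ordered_class K lt \<longleftrightarrow> (lt, 2) \<in> rels (lang_of K) \<and>
     (\<forall>I\<in>members K.
        irreflp_on (carrier I) (\<lambda>x y. rl I lt [x, y]) \<and>
        transp_on (carrier I) (\<lambda>x y. rl I lt [x, y]) \<and>
        totalp_on (carrier I) (\<lambda>x y. rl I lt [x, y]))"

definition same_type ::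
  "'u abs_class \<Rightarrow> 'u struc \<Rightarrow> 'u list \<Rightarrow> 'u struc \<Rightarrow> 'u list \<Rightarrow> bool" where
  "same_type K I\<^sub>1 a\<^sub>1 I\<^sub>2 a\<^sub>2 \<longleftrightarrow>
     (\<exists>(n :: nat) J I' b h.
        I' 1 = I\<^sub>1 \<and> I' (n + 1) = I\<^sub>2 \<and> b 1 = a\<^sub>1 \<and> b (n + 1) = a\<^sub>2 \<and>
        (\<forall>l\<in>{1..n + 1}. I' l \<in> members K \<and> set (b l) \<subseteq> carrier (I' l)) \<and>
        (\<forall>l\<in>{1..n}. J l \<in> members K \<and> (I' l, J l) \<in> leq K \<and>
           K_embedding K (h l) (I' (l + 1)) (J l) \<and> b l = map (h l) (b (l + 1))))"

type_synonym 'u ktype = "('u struc \<times> 'u list) set"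

definition tp :: "'u abs_class \<Rightarrow> 'u struc \<Rightarrow> 'u list \<Rightarrow> 'u ktype" where
  "tp K I a = {(J, b). J \<in> members K \<and> set b \<subseteq> carrier J \<and> same_type K I a J b}"

definition S_n :: "'u abs_class \<Rightarrow> nat \<Rightarrow> 'u ktype set" where
  "S_n K n = {tp K I a | I a. I \<in> members K \<and> set a \<subseteq> carrier I \<and> length a = n}"

definition S_all :: "'u abs_class \<Rightarrow> 'u ktype set" where
  "S_all K = (\<Union>n. S_n K n)"

definition increasing :: "'u \<Rightarrow> 'u struc \<Rightarrow> 'u list \<Rightarrow> bool" where
  "increasing lt I a \<longleftrightarrow> set a \<subseteq> carrier I \<and> sorted_wrt (\<lambda>x y. rl I lt [x, y]) a"

definition S_inc_n :: "'u abs_class \<Rightarrow> 'u \<Rightarrow> nat \<Rightarrow> 'u ktype set" where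
  "S_inc_n K lt n = {tp K I a | I a. I \<in> members K \<and> increasing lt I a \<and> length a = n}"

definition S_inc :: "'u abs_class \<Rightarrow> 'u \<Rightarrow> 'u ktype set" where
  "S_inc K lt = (\<Union>n. S_inc_n K lt n)"

text \<open>
  The type \<open>p\<^sup>s\<close>, with indices counted from 0.  As all representatives of \<open>p\<close> yield the same
  restricted type, the union is that type.
\<close>

definition type_at :: "'u abs_class \<Rightarrow> 'u ktype \<Rightarrow> nat set \<Rightarrow> 'u ktype" where
  "type_at K p s = (\<Union>(I, a)\<in>p. tp K I (nths a s))"

definition all_strucs :: "'u lang \<Rightarrow> 'u abs_class" where
  "all_strucs L = \<lparr>lang_of = L, members = {M. is_struc L M}, leq = {(M, N). substruc L M N}\<rparr>"

text \<open>The reduct of a type, again given by the union over all representatives.\<close>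

definition type_reduct :: "'u lang \<Rightarrow> 'u ktype \<Rightarrow> 'u ktype" where
  "type_reduct L q = (\<Union>(M, a)\<in>q. tp (all_strucs L) (reduct L M) a)"


section \<open>Bigness, blueprints and Ehrenfeucht-Mostowski models\<close>

definition bigness_notion :: "'u abs_class \<Rightarrow> ('u cardinal \<Rightarrow> 'u struc set) \<Rightarrow> bool" where
  "bigness_notion K Big \<longleftrightarrow>
     (\<forall>\<mu>. Big \<mu> \<subseteq> members K \<and> Big \<mu> \<noteq> {}) \<and>
     (\<forall>\<mu>\<^sub>1 \<mu>\<^sub>2 M N. \<mu>\<^sub>1 \<le> \<mu>\<^sub>2 \<longrightarrow> (M, N) \<in> leq K \<longrightarrow> M \<in> Big \<mu>\<^sub>2 \<longrightarrow> N \<in> Big \<mu>\<^sub>1) \<and>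
     (\<forall>M\<in>Big aleph0. \<forall>p\<in>S_all K. \<exists>a. set a \<subseteq> carrier M \<and> tp K M a = p)"

definition blueprint ::
  "'u abs_class \<Rightarrow> 'u \<Rightarrow> 'u lang \<Rightarrow> ('u ktype \<Rightarrow> 'u ktype) \<Rightarrow> bool" where
  "blueprint K lt \<sigma> \<Phi> \<longleftrightarrow> is_lang \<sigma> \<and>
     (\<forall>n. \<forall>p\<in>S_inc_n K lt n. \<Phi> p \<in> S_n (all_strucs \<sigma>) n \<and>
        (\<forall>s\<subseteq>{..<n}. \<Phi> (type_at K p s) = type_at (all_strucs \<sigma>) (\<Phi> p) s))"

text \<open>
  \<open>is_EM\<close> says that \<open>N\<close> is a structure EM(I, \<open>\<Phi>\<close>).  Such an \<open>N\<close> is unique only up to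
  isomorphism over the carrier of \<open>I\<close>.
\<close>

definition is_EM :: "'u abs_class \<Rightarrow> 'u \<Rightarrow> 'u lang \<Rightarrow> ('u ktype \<Rightarrow> 'u ktype) \<Rightarrow>
    'u struc \<Rightarrow> 'u struc \<Rightarrow> bool" where
  "is_EM K lt \<sigma> \<Phi> I N \<longleftrightarrow> is_struc \<sigma> N \<and> carrier I \<subseteq> carrier N \<and>
     (\<forall>x\<in>carrier N. \<exists>t v. wf_trm \<sigma> t \<and> range v \<subseteq> carrier I \<and> x = eval_trm N v t) \<and>
     (\<forall>a. increasing lt I a \<longrightarrow> tp (all_strucs \<sigma>) N a = \<Phi> (tp K I a))"

text \<open>
  The third argument is the language of the target class \<open>\<KK>\<close>, whose members and order are
  the last two arguments.  For \<open>I \<le> J\<close>, the structure EM(I, \<open>\<Phi>\<close>) is the substructure of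
  EM(J, \<open>\<Phi>\<close>) generated by \<open>I\<close>, which is why the last clause is about pairs of Ehrenfeucht-Mostowski
  models of which the first one is a substructure of the second one.
\<close>

definition Upsilon :: "'u abs_class \<Rightarrow> 'u \<Rightarrow> 'u lang \<Rightarrow> 'u cardinal \<Rightarrow>
    'u struc set \<Rightarrow> ('u struc \<times> 'u struc) set \<Rightarrow> ('u lang \<times> ('u ktype \<Rightarrow> 'u ktype)) set" where
  "Upsilon K lt \<tau> \<kappa> \<KK> prec = {(\<sigma>, \<Phi>).
     blueprint K lt \<sigma> \<Phi> \<and> sublang \<tau> \<sigma> \<and> lang_card \<sigma> \<le> \<kappa> \<and>
     (\<forall>I\<in>members K.
        (\<exists>N. is_EM K lt \<sigma> \<Phi> I N) \<and> (\<forall>N. is_EM K lt \<sigma> \<Phi> I N \<longrightarrow> reduct \<tau> N \<in> \<KK>)) \<and>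
     (\<forall>(I, J)\<in>leq K. \<forall>M N. is_EM K lt \<sigma> \<Phi> I M \<longrightarrow> is_EM K lt \<sigma> \<Phi> J N \<longrightarrow>
        substruc \<sigma> M N \<longrightarrow> (reduct \<tau> M, reduct \<tau> N) \<in> prec)}"


section \<open>Cofinal Erd\<odieresis>s-Rado classes and PC pairs\<close>

definition cofinal_ER_class :: "'u abs_class \<Rightarrow> 'u \<Rightarrow> ('u cardinal \<Rightarrow> 'u struc set) \<Rightarrow>
    ('u cardinal \<Rightarrow> 'u cardinal) \<Rightarrow> bool" where
  "cofinal_ER_class K lt Big f \<longleftrightarrow>
     abstract_class K \<and> ordered_class K lt \<and> bigness_notion K Big \<and>
     (\<forall>\<mu> \<sigma> M I F. is_lang \<sigma> \<longrightarrow> lang_card \<sigma> \<le> \<mu> \<longrightarrow>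
        (\<forall>\<alpha><f \<mu>. is_struc \<sigma> (M \<alpha>) \<and> I \<alpha> \<in> Big \<alpha> \<and>
           inj_on (F \<alpha>) (carrier (I \<alpha>)) \<and> F \<alpha> ` carrier (I \<alpha>) \<subseteq> carrier (M \<alpha>)) \<longrightarrow>
        (\<exists>\<Phi>. blueprint K lt \<sigma> \<Phi> \<and>
           (\<forall>p\<in>S_inc K lt. cofinally_many_below (f \<mu>) (\<lambda>\<alpha>.
              \<exists>i. increasing lt (I \<alpha>) i \<and> tp K (I \<alpha>) i = p \<and>
                  tp (all_strucs \<sigma>) (M \<alpha>) (map (F \<alpha>) i) = \<Phi> p))))"

definition PC_pair :: "'u lang \<Rightarrow> 'u struc set \<Rightarrow> ('u struc \<times> 'u struc) set \<Rightarrow> 'u lang \<Rightarrow> bool" where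
  "PC_pair \<tau> \<KK> prec \<tau>\<^sub>1 \<longleftrightarrow>
     is_lang \<tau> \<and> is_lang \<tau>\<^sub>1 \<and> sublang \<tau> \<tau>\<^sub>1 \<and>
     (\<forall>M\<in>\<KK>. is_struc \<tau> M) \<and> prec \<subseteq> \<KK> \<times> \<KK> \<and> partial_order_on \<KK> prec \<and>
     (\<exists>T\<^sub>1 \<Gamma>. is_theory \<tau>\<^sub>1 T\<^sub>1 \<and> (\<forall>q\<in>\<Gamma>. is_syntactic_type \<tau>\<^sub>1 q) \<and>
        (\<forall>M. is_struc \<tau> M \<longrightarrow>
           (M \<in> \<KK> \<longleftrightarrow>
            (\<exists>M\<^sub>1. expansion \<tau> M \<tau>\<^sub>1 M\<^sub>1 \<and> models M\<^sub>1 T\<^sub>1 \<and> (\<forall>q\<in>\<Gamma>. omits M\<^sub>1 q)))) \<and>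
        (\<forall>M\<in>\<KK>. \<forall>N\<in>\<KK>.
           (M, N) \<in> prec \<longleftrightarrow>
           (\<exists>M\<^sub>1 N\<^sub>1. expansion \<tau> M \<tau>\<^sub>1 M\<^sub>1 \<and> models M\<^sub>1 T\<^sub>1 \<and> (\<forall>q\<in>\<Gamma>. omits M\<^sub>1 q) \<and>
                    expansion \<tau> N \<tau>\<^sub>1 N\<^sub>1 \<and> models N\<^sub>1 T\<^sub>1 \<and> (\<forall>q\<in>\<Gamma>. omits N\<^sub>1 q) \<and>
                    substruc \<tau>\<^sub>1 M\<^sub>1 N\<^sub>1)))"

end

theory Submission
  imports Defs
begin

text \<open>
  Expand the structures \<open>M \<alpha>\<close> to models \<open>M\<^sub>1 \<alpha>\<close> of \<open>T\<^sub>1\<close> that omit the types in \<open>\<Gamma>\<close>, and expand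
  these further to structures \<open>B \<alpha>\<close> by Skolem functions for all formulas of \<open>\<tau>\<^sub>1\<close>.  The language
  \<open>\<sigma>\<close> of the \<open>B \<alpha>\<close> is not larger than \<open>\<tau>\<^sub>1\<close> (\<open>skolem_names_exist\<close>), so the Erd\<odieresis>s-Rado property
  yields a blueprint \<open>\<Phi>\<close> with \<open>\<tau>(\<Phi>) = \<sigma>\<close> all of whose values are types of tuples
  \<open>F \<alpha> (i\<^sub>1), \<dots>, F \<alpha> (i\<^sub>n)\<close> in the structures \<open>B \<alpha>\<close>, for cofinally many \<open>\<alpha>\<close>.  The reduct to
  \<open>\<tau>\<close> of this statement is the second part of the conclusion (\<open>type_reduct_tp\<close>).

  It remains to see that \<open>\<Phi>\<close> belongs to \<open>\<Upsilon>\<close>.  A finite tuple of \<open>EM(I, \<Phi>)\<close> consists of values of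
  \<open>\<sigma>\<close>-terms at an increasing tuple of \<open>I\<close>, whose quantifier-free type is realized in some \<open>B \<alpha>\<close>; so
  it has itself the quantifier-free \<open>\<sigma>\<close>-type of a tuple in some \<open>B \<alpha>\<close> (\<open>EM_finitely_realized\<close>).
  Thanks to the Skolem functions the two tuples then satisfy the same formulas of \<open>\<tau>\<^sub>1\<close>
  (\<open>skolem_transfer\<close>).  Therefore the reduct of \<open>EM(I, \<Phi>)\<close> to \<open>\<tau>\<^sub>1\<close> is a model of \<open>T\<^sub>1\<close> that omits
  the types in \<open>\<Gamma>\<close>, which puts its reduct to \<open>\<tau>\<close> into \<open>\<KK>\<close>.  If one Ehrenfeucht-Mostowski model is
  a substructure of another one for \<open>\<sigma>\<close>, then it is so for \<open>\<tau>\<^sub>1\<close>, and these reducts witness that the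
  reducts to \<open>\<tau>\<close> are comparable in the order of \<open>\<KK>\<close>.

  Two general facts are needed on the way.  Types in the class of all \<open>\<sigma>\<close>-structures, defined by
  chains of embeddings, are determined by the atomic formulas that hold
  (\<open>same_atomic_if_type_steps\<close>, \<open>type_steps_if_same_atomic\<close>).  And \<open>EM(I, \<Phi>)\<close> exists, with \<open>I\<close>
  itself as a subset (\<open>EM_exists\<close>): it is the part generated by \<open>I\<close> of a reduced product
  of structures that realize the values of \<open>\<Phi>\<close>.
\<close>

section \<open>Counting lists, terms and formulas\<close>

unbundle cardinal_syntax

lemma lesspoll_iff_ordLess: "A \<prec> B \<longleftrightarrow> |A| <o |B|"
  unfolding lesspoll_def lepoll_def eqpoll_def
  by (metis card_of_ordIso card_of_ordLeq not_ordLess_ordLeq ordLeq_iff_ordLess_or_ordIso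
      ordIso_ordLess_trans ordIso_symmetric not_ordLess_ordIso)

lemma Plus_lesspoll:
  assumes "infinite C" "A \<prec> C" "B \<prec> C"
  shows "A <+> B \<prec> C"
  using assms card_of_Plus_ordLess_infinite by (simp add: lesspoll_iff_ordLess)

lemma Plus_lepoll:
  assumes "A \<lesssim> X" "B \<lesssim> X" "infinite X"
  shows "A <+> B \<lesssim> X"
proof -
  have "|X <+> X| =o |X|"
    using assms(3) by (intro card_of_Plus_infinite1) (auto intro: card_of_refl ordIso_imp_ordLeq)
  then have "X <+> X \<lesssim> X"
    unfolding lepoll_def by (metis card_of_ordLeq ordIso_iff_ordLeq)
  then show ?thesis
    using sum_lepoll_mono[OF assms(1,2)] lepoll_trans by blast
qed

lemma Un_lepoll_Plus: "A \<union> B \<lesssim> A <+> B"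
proof -
  have "A \<union> B = (\<lambda>z. case z of Inl x \<Rightarrow> x | Inr x \<Rightarrow> x) ` (A <+> B)"
    by (force simp: image_iff)
  then show ?thesis
    using image_lepoll by metis
qed

lemma Un_lepoll: "A \<lesssim> X \<Longrightarrow> B \<lesssim> X \<Longrightarrow> infinite X \<Longrightarrow> A \<union> B \<lesssim> X"
  using Plus_lepoll Un_lepoll_Plus lepoll_trans by blast

lemma lepoll_complement:
  fixes A :: "'a set"
  assumes "infinite (UNIV :: 'a set)" "A \<prec> (UNIV :: 'a set)"
  shows "(UNIV :: 'a set) \<lesssim> UNIV - A"
proof (rule ccontr)
  assume "\<not> (UNIV :: 'a set) \<lesssim> UNIV - A"
  then have "UNIV - A \<prec> (UNIV :: 'a set)"
    using lepoll_linear by (metis lepoll_iff_leqpoll eqpoll_imp_lepoll eqpoll_sym)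
  then have "(UNIV - A) <+> A \<prec> (UNIV :: 'a set)"
    using assms Plus_lesspoll by blast
  moreover have "(UNIV :: 'a set) \<lesssim> (UNIV - A) <+> A"
    using Un_lepoll_Plus[of "UNIV - A" A] by simp
  ultimately show False
    using lesspoll_trans1 by blast
qed

lemma nat_lesspoll_uncountable:
  assumes "uncountable A"
  shows "(UNIV :: nat set) \<prec> A"
proof -
  have "\<not> A \<lesssim> (UNIV :: nat set)"
    using assms countable_lepoll countableI_type by blast
  then show ?thesis
    using lepoll_linear unfolding lesspoll_def by (meson eqpoll_imp_lepoll eqpoll_sym)
qed

lemma Times_lepoll:
  assumes "A \<lesssim> X" "B \<lesssim> X" "infinite X"
  shows "A \<times> B \<lesssim> X"
proof -
  have "|X \<times> X| =o |X|"
    using assms(3) by (rule card_of_Times_same_infinite)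
  then have "X \<times> X \<lesssim> X"
    unfolding lepoll_def by (metis card_of_ordLeq ordIso_iff_ordLeq)
  then show ?thesis
    using times_lepoll_mono[OF assms(1,2)] lepoll_trans by blast
qed

lemma lists_lepoll:
  assumes "A \<lesssim> X" "infinite X"
  shows "lists A \<lesssim> X"
proof -
  have level: "{xs \<in> lists A. length xs = n} \<lesssim> X" for n
  proof (induction n)
    case 0
    have "{xs \<in> lists A. length xs = 0} = {[]}"
      by auto
    then show ?case
      using assms(2) finite_lepoll_infinite by (metis finite.simps)
  next
    case (Suc n)
    have "{xs \<in> lists A. length xs = Suc n} \<subseteq>
        (\<lambda>(x, xs). x # xs) ` (A \<times> {xs \<in> lists A. length xs = n})"
      by (auto simp: length_Suc_conv image_iff)
    then have "{xs \<in> lists A. length xs = Suc n} \<lesssim> A \<times> {xs \<in> lists A. length xs = n}"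
      by (rule subset_image_lepoll)
    then show ?case
      using Times_lepoll[OF assms(1) Suc assms(2)] lepoll_trans by blast
  qed
  have "|\<Union>n. {xs \<in> lists A. length xs = n}| \<le>o |X|"
  proof (rule card_of_UNION_ordLeq_infinite)
    show "|UNIV :: nat set| \<le>o |X|"
      using assms(2) infinite_iff_card_of_nat by blast
    show "\<forall>n\<in>UNIV. |{xs \<in> lists A. length xs = n}| \<le>o |X|"
      using level unfolding lepoll_def card_of_ordLeq by blast
  qed (use assms(2) in simp)
  moreover have "(\<Union>n. {xs \<in> lists A. length xs = n}) = lists A"
    by auto
  ultimately show ?thesis
    unfolding lepoll_def by (metis card_of_ordLeq)
qed

unbundle no cardinal_syntax

instance trm :: (countable) countable
  by countable_datatype

instance fm :: (countable) countable
  by countable_datatype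

lemma finite_set_trm [simp]: "finite (set_trm t)"
  by (induction t) auto

lemma finite_set_fm [simp]: "finite (set_fm \<phi>)"
  by (induction \<phi>) auto

text \<open>
  An object with finitely many labels from \<open>A\<close> is obtained from one whose labels are numbers by
  replacing each number by the entry of a list over \<open>A\<close> at that position, and there are
  countably many objects of the latter kind.  This counts terms and formulas without coding
  their syntax.
\<close>

lemma relabelled_lepoll:
  fixes m :: "(nat \<Rightarrow> 'a) \<Rightarrow> 's::countable \<Rightarrow> 't"
  assumes "A \<lesssim> X" "infinite X"
    and "\<And>t. t \<in> T \<Longrightarrow> \<exists>s xs. set xs \<subseteq> A \<and> t = m (\<lambda>k. xs ! k) s"
  shows "T \<lesssim> X"
proof -
  have "T \<subseteq> (\<lambda>(s, xs). m (\<lambda>k. xs ! k) s) ` ((UNIV :: 's set) \<times> lists A)"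
  proof
    fix t
    assume "t \<in> T"
    then obtain s xs where "set xs \<subseteq> A" "t = m (\<lambda>k. xs ! k) s"
      using assms(3) by blast
    then show "t \<in> (\<lambda>(s, xs). m (\<lambda>k. xs ! k) s) ` ((UNIV :: 's set) \<times> lists A)"
      by (intro image_eqI[of _ _ "(s, xs)"]) auto
  qed
  moreover have "(UNIV :: 's set) \<lesssim> (UNIV :: nat set)"
    unfolding lepoll_def using inj_to_nat by blast
  then have "(UNIV :: 's set) \<lesssim> X"
    using assms(2) unfolding infinite_le_lepoll by (rule lepoll_trans)
  then have "(UNIV :: 's set) \<times> lists A \<lesssim> X"
    using lists_lepoll[OF assms(1,2)] assms(2) by (intro Times_lepoll)
  ultimately show ?thesis
    using subset_image_lepoll lepoll_trans by blast
qed

lemma finite_list_index: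
  assumes "finite S"
  shows "\<exists>xs idx. set xs = S \<and> (\<forall>x\<in>S. idx x < length xs \<and> xs ! idx x = x)"
proof -
  obtain xs where "set xs = S"
    using finite_list[OF assms] by blast
  then have "\<forall>x\<in>S. \<exists>j. j < length xs \<and> xs ! j = x"
    by (metis in_set_conv_nth)
  then show ?thesis
    using \<open>set xs = S\<close> by metis
qed

lemma terms_lepoll:
  assumes "A \<lesssim> X" "infinite X"
  shows "{t. set_trm t \<subseteq> A} \<lesssim> X"
proof (rule relabelled_lepoll[OF assms, of _ map_trm])
  fix t
  assume "t \<in> {t. set_trm t \<subseteq> A}"
  obtain xs idx where xs: "set xs = set_trm t" "\<forall>x\<in>set_trm t. idx x < length xs \<and> xs ! idx x = x"
    using finite_list_index[OF finite_set_trm[of t]] by metis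
  have "map_trm (\<lambda>k. xs ! k) (map_trm idx t) = map_trm id t"
    unfolding trm.map_comp using xs(2) by (intro trm.map_cong0) simp
  then show "\<exists>s xs. set xs \<subseteq> A \<and> t = map_trm (\<lambda>k. xs ! k) s"
    using \<open>t \<in> _\<close> xs(1)
    by (intro exI[of _ "map_trm idx t"] exI[of _ xs]) (simp add: trm.map_id)
qed

lemma formulas_lepoll:
  assumes "A \<lesssim> X" "infinite X"
  shows "{\<phi>. set_fm \<phi> \<subseteq> A} \<lesssim> X"
proof (rule relabelled_lepoll[OF assms, of _ map_fm])
  fix \<phi>
  assume "\<phi> \<in> {\<phi>. set_fm \<phi> \<subseteq> A}"
  obtain xs idx where xs: "set xs = set_fm \<phi>" "\<forall>x\<in>set_fm \<phi>. idx x < length xs \<and> xs ! idx x = x"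
    using finite_list_index[OF finite_set_fm[of \<phi>]] by metis
  have "map_fm (\<lambda>k. xs ! k) (map_fm idx \<phi>) = map_fm id \<phi>"
    unfolding fm.map_comp using xs(2) by (intro fm.map_cong0) simp
  then show "\<exists>s xs. set xs \<subseteq> A \<and> \<phi> = map_fm (\<lambda>k. xs ! k) s"
    using \<open>\<phi> \<in> _\<close> xs(1)
    by (intro exI[of _ "map_fm idx \<phi>"] exI[of _ xs]) (simp add: fm.map_id)
qed

lemma set_trm_wf: "wf_trm L t \<Longrightarrow> set_trm t \<subseteq> fst ` funs L"
proof (induction t)
  case (App g ts)
  then have "g \<in> fst ` funs L"
    by (auto intro: image_eqI[of _ _ "(g, length ts)"])
  with App show ?case
    by auto
qed simp

lemma set_fm_wf: "wf_fm L \<phi> \<Longrightarrow> set_fm \<phi> \<subseteq> fst ` funs L \<union> fst ` rels L"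
proof (induction \<phi>)
  case (Eq s t)
  then show ?case
    using set_trm_wf[of L s] set_trm_wf[of L t] by auto
next
  case (Rel r ts)
  then have "r \<in> fst ` rels L"
    by (auto intro: image_eqI[of _ _ "(r, length ts)"])
  with Rel show ?case
    using set_trm_wf[of L] by auto
qed auto

lemma cardinality_mono:
  assumes "A \<lesssim> B" "B \<prec> (UNIV :: 'u set)"
  shows "(cardinality A :: 'u cardinal) \<le> cardinality B"
proof -
  have rep: "(SOME C :: 'u set. C \<approx> D) \<approx> D" if small: "D \<prec> (UNIV :: 'u set)" for D :: "'c set"
  proof -
    obtain g :: "'c \<Rightarrow> 'u" where "inj_on g D"
      using small unfolding lesspoll_def lepoll_def by blast
    then have "g ` D \<approx> D"
      by (rule inj_on_image_eqpoll_self)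
    then show ?thesis
      by (rule someI)
  qed
  have A: "A \<prec> (UNIV :: 'u set)"
    using assms lesspoll_trans1 by blast
  let ?A = "SOME C :: 'u set. C \<approx> A" and ?B = "SOME C :: 'u set. C \<approx> B"
  have "?A \<lesssim> ?B"
    using rep[OF A] rep[OF assms(2)] assms(1) by (meson eqpoll_sym lepoll_trans1 lepoll_trans2)
  moreover have "?A \<prec> (UNIV :: 'u set)" "?B \<prec> (UNIV :: 'u set)"
    using rep A assms(2) eq_lesspoll_trans by blast+
  ultimately show ?thesis
    unfolding cardinality_def by (simp add: less_eq_cardinal.abs_eq small_eqpoll_def)
qed

section \<open>Substitution, reducts and substructures\<close>

fun subst_trm :: "(nat \<Rightarrow> 'u trm) \<Rightarrow> 'u trm \<Rightarrow> 'u trm" where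
  "subst_trm s (Var k) = s k"
| "subst_trm s (App g ts) = App g (map (subst_trm s) ts)"

lemma eval_subst_trm: "eval_trm M v (subst_trm s t) = eval_trm M (\<lambda>k. eval_trm M v (s k)) t"
  by (induction t) (auto simp: comp_def cong: map_cong)

lemma wf_subst_trm: "wf_trm L t \<Longrightarrow> (\<And>k. wf_trm L (s k)) \<Longrightarrow> wf_trm L (subst_trm s t)"
  by (induction t) auto

lemma finite_fv_trm [simp]: "finite (fv_trm t)"
  by (induction t) auto

lemma finite_fv_fm [simp]: "finite (fv_fm \<phi>)"
  by (induction \<phi>) auto

lemma eval_trm_cong: "(\<And>k. k \<in> fv_trm t \<Longrightarrow> v k = w k) \<Longrightarrow> eval_trm M v t = eval_trm M w t"
proof (induction t)
  case (App g ts)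
  have "eval_trm M v t = eval_trm M w t" if "t \<in> set ts" for t
    using that App.prems by (intro App.IH) auto
  then have "map (eval_trm M v) ts = map (eval_trm M w) ts"
    by simp
  then show ?case
    by (simp only: eval_trm.simps)
qed simp

lemma sat_cong: "(\<And>k. k \<in> fv_fm \<phi> \<Longrightarrow> v k = w k) \<Longrightarrow> sat M v \<phi> = sat M w \<phi>"
proof (induction \<phi> arbitrary: v w)
  case (Eq s t)
  then show ?case
    using eval_trm_cong[of s v w M] eval_trm_cong[of t v w M] by auto
next
  case (Rel r ts)
  have "eval_trm M v t = eval_trm M w t" if "t \<in> set ts" for t
    using that Rel by (intro eval_trm_cong) auto
  then have "map (eval_trm M v) ts = map (eval_trm M w) ts"
    by simp
  then show ?case
    by (simp only: sat.simps)
next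
  case (Neg \<phi>)
  then have "sat M v \<phi> = sat M w \<phi>"
    by (intro Neg.IH) simp
  then show ?case by simp
next
  case (And \<phi> \<psi>)
  have "sat M v \<phi> = sat M w \<phi>"
    by (intro And.IH(1) And.prems) simp
  moreover have "sat M v \<psi> = sat M w \<psi>"
    by (intro And.IH(2) And.prems) simp
  ultimately show ?case by simp
next
  case (Ex k \<phi>)
  then have "sat M (v(k := x)) \<phi> = sat M (w(k := x)) \<phi>" for x
    by (intro Ex.IH) auto
  then show ?case by simp
qed

lemma eval_trm_in_carrier:
  assumes "is_struc L M" "range v \<subseteq> carrier M"
  shows "wf_trm L t \<Longrightarrow> eval_trm M v t \<in> carrier M"
proof (induction t)
  case (App g ts)
  then have "(g, length (map (eval_trm M v) ts)) \<in> funs L" "set (map (eval_trm M v) ts) \<subseteq> carrier M"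
    by auto
  then have "fn M g (map (eval_trm M v) ts) \<in> carrier M"
    using assms(1) unfolding is_struc_def by metis
  then show ?case by simp
qed (use assms in auto)

lemma wf_trm_mono: "sublang L L' \<Longrightarrow> wf_trm L t \<Longrightarrow> wf_trm L' t"
  by (induction t) (auto simp: sublang_def)

lemma wf_fm_mono: "sublang L L' \<Longrightarrow> wf_fm L \<phi> \<Longrightarrow> wf_fm L' \<phi>"
  by (induction \<phi>) (auto simp: wf_trm_mono, auto simp: sublang_def)

lemma sublang_trans: "sublang L L' \<Longrightarrow> sublang L' L'' \<Longrightarrow> sublang L L''"
  by (auto simp: sublang_def)

lemma carrier_reduct [simp]: "carrier (reduct L M) = carrier M"
  by (simp add: reduct_def)

lemma fn_reduct: "(g, length xs) \<in> funs L \<Longrightarrow> fn (reduct L M) g xs = fn M g xs"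
  by (simp add: reduct_def)

lemma rl_reduct: "(r, length xs) \<in> rels L \<Longrightarrow> rl (reduct L M) r xs = rl M r xs"
  by (simp add: reduct_def)

lemma eval_trm_reduct: "wf_trm L t \<Longrightarrow> eval_trm (reduct L M) v t = eval_trm M v t"
proof (induction t)
  case (App g ts)
  then have "map (eval_trm (reduct L M) v) ts = map (eval_trm M v) ts"
    by auto
  then show ?case
    using App.prems fn_reduct[of g "map (eval_trm M v) ts" L M]
    by (simp only: eval_trm.simps wf_trm.simps length_map)
qed simp

lemma sat_reduct: "wf_fm L \<phi> \<Longrightarrow> sat (reduct L M) v \<phi> = sat M v \<phi>"
proof (induction \<phi> arbitrary: v)
  case (Rel r ts)
  then have "map (eval_trm (reduct L M) v) ts = map (eval_trm M v) ts"
    by (auto simp: eval_trm_reduct)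
  then show ?case
    using Rel.prems rl_reduct[of r "map (eval_trm M v) ts" L M]
    by (simp only: sat.simps wf_fm.simps length_map)
next
  case (Ex k \<phi>)
  then show ?case by simp
qed (auto simp: eval_trm_reduct)

lemma is_struc_reduct: "is_struc L' M \<Longrightarrow> sublang L L' \<Longrightarrow> is_struc L (reduct L M)"
  unfolding is_struc_def sublang_def reduct_def by (auto split: if_splits) blast+

lemma reduct_reduct: "sublang L L' \<Longrightarrow> reduct L (reduct L' M) = reduct L M"
  unfolding reduct_def sublang_def by (auto intro!: ext)

lemma carrier_induced [simp]: "carrier (induced N A) = A"
  by (simp add: induced_def)

lemma reduct_induced: "reduct L (induced N A) = induced (reduct L N) A"
  unfolding reduct_def induced_def by (auto intro!: ext)

lemma substruc_reduct:
  "substruc L' M N \<Longrightarrow> sublang L L' \<Longrightarrow> substruc L (reduct L M) (reduct L N)"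
  unfolding substruc_def using is_struc_reduct by (auto simp: reduct_def sublang_def)

lemma substruc_refl: "is_struc L M \<Longrightarrow> substruc L M M"
  by (simp add: substruc_def)

lemma induced_substruc:
  assumes "substruc L M N"
  shows "induced N (carrier M) = M"
proof -
  have "(if set xs \<subseteq> carrier M then fn N g xs else undefined) = fn M g xs" for g xs
    using assms unfolding substruc_def is_struc_def by (smt (verit, best) subset_trans)
  moreover have "(set xs \<subseteq> carrier M \<and> rl N r xs) = rl M r xs" for r xs
    using assms unfolding substruc_def is_struc_def by blast
  ultimately show ?thesis
    unfolding induced_def by simp
qed

lemma substruc_induced:
  assumes N: "is_struc L N" and A: "A \<subseteq> carrier N" "A \<noteq> {}"
    and closed: "\<And>g xs. (g, length xs) \<in> funs L \<Longrightarrow> set xs \<subseteq> A \<Longrightarrow> fn N g xs \<in> A"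
  shows "substruc L (induced N A) N"
proof -
  have "A \<prec> (UNIV :: 'a set)"
    using N A(1) subset_imp_lepoll lesspoll_trans1 unfolding is_struc_def by blast
  moreover have "(g, length xs) \<notin> funs L \<Longrightarrow> fn N g xs = undefined" for g xs
    using N unfolding is_struc_def by metis
  moreover have "rl N r xs \<Longrightarrow> (r, length xs) \<in> rels L" for r xs
    using N unfolding is_struc_def by blast
  ultimately have "is_struc L (induced N A)"
    using A closed unfolding is_struc_def by (auto simp: induced_def)
  then show ?thesis
    using N A unfolding substruc_def by (simp add: induced_def)
qed

lemma eval_trm_substruc:
  assumes "substruc L M N" "range v \<subseteq> carrier M"
  shows "wf_trm L t \<Longrightarrow> eval_trm M v t = eval_trm N v t"
proof (induction t)
  case (App g ts)
  then have eq: "map (eval_trm M v) ts = map (eval_trm N v) ts"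
    by auto
  have "set (map (eval_trm M v) ts) \<subseteq> carrier M"
    using App.prems assms eval_trm_in_carrier[of L M v] unfolding substruc_def by auto
  moreover have "(g, length (map (eval_trm M v) ts)) \<in> funs L"
    using App.prems by simp
  ultimately have "fn M g (map (eval_trm M v) ts) = fn N g (map (eval_trm M v) ts)"
    using assms(1) unfolding substruc_def by blast
  then show ?case
    by (simp only: eq eval_trm.simps)
qed simp

lemma sat_atomic_substruc:
  assumes "substruc L M N" "range v \<subseteq> carrier M" "atomic \<phi>" "wf_fm L \<phi>"
  shows "sat M v \<phi> = sat N v \<phi>"
proof (cases \<phi>)
  case (Eq s t)
  then show ?thesis
    using assms eval_trm_substruc[OF assms(1,2)] by simp
next
  case (Rel r ts)
  then have eq: "map (eval_trm M v) ts = map (eval_trm N v) ts"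
    using assms eval_trm_substruc[OF assms(1,2)] by simp
  have "set (map (eval_trm M v) ts) \<subseteq> carrier M"
    using Rel assms eval_trm_in_carrier[of L M v] unfolding substruc_def by auto
  moreover have "(r, length (map (eval_trm M v) ts)) \<in> rels L"
    using Rel assms by simp
  ultimately have "rl M r (map (eval_trm M v) ts) = rl N r (map (eval_trm M v) ts)"
    using assms(1) unfolding substruc_def by blast
  then show ?thesis
    by (simp only: eq Rel sat.simps)
qed (use assms in auto)

lemma atomic_embeddingD:
  assumes "atomic_embedding L h M N"
  shows "inj_on h (carrier M)" "h ` carrier M \<subseteq> carrier N"
    "atomic \<phi> \<Longrightarrow> wf_fm L \<phi> \<Longrightarrow> range v \<subseteq> carrier M \<Longrightarrow> sat M v \<phi> = sat N (h \<circ> v) \<phi>"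
  using assms by (simp_all only: atomic_embedding_def)

lemma atomic_embedding_id: "substruc L M N \<Longrightarrow> atomic_embedding L id M N"
  unfolding atomic_embedding_def using sat_atomic_substruc[of L M N] by (simp add: substruc_def)

lemma atomic_embedding_eval_trm:
  assumes h: "atomic_embedding L h M N" and M: "is_struc L M"
    and v: "range v \<subseteq> carrier M" and t: "wf_trm L t"
  shows "h (eval_trm M v t) = eval_trm N (h \<circ> v) t"
proof -
  \<comment> \<open>The equation \<open>t = x\<close>, for a new variable \<open>x\<close> that denotes the value of \<open>t\<close>, is atomic.\<close>
  obtain m where m: "m \<notin> fv_trm t"
    using ex_new_if_finite[OF infinite_UNIV_nat finite_fv_trm] by blast
  define u where "u = v(m := eval_trm M v t)"
  have "range u \<subseteq> carrier M"
    using v eval_trm_in_carrier[OF M v t] by (auto simp: u_def)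
  moreover have "eval_trm M u t = eval_trm M v t"
    using m by (intro eval_trm_cong) (auto simp: u_def)
  then have "sat M u (Eq t (Var m))"
    by (simp add: u_def)
  ultimately have "sat N (h \<circ> u) (Eq t (Var m))"
    using h t unfolding atomic_embedding_def by (metis atomic.simps(1) wf_fm.simps(1) wf_trm.simps(1))
  moreover have "eval_trm N (h \<circ> u) t = eval_trm N (h \<circ> v) t"
    using m by (intro eval_trm_cong) (auto simp: u_def)
  ultimately show ?thesis
    by (simp add: u_def)
qed

lemma atomic_embedding_fn:
  assumes h: "atomic_embedding L h M N" and M: "is_struc L M"
    and "(g, length xs) \<in> funs L" "set xs \<subseteq> carrier M"
  shows "h (fn M g xs) = fn N g (map h xs)"
proof -
  obtain c where c: "c \<in> carrier M"
    using M unfolding is_struc_def by blast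
  define v where "v k = (if k < length xs then xs ! k else c)" for k
  have "range v \<subseteq> carrier M"
    using assms(4) c by (auto simp: v_def)
  moreover have "map v [0..<length xs] = xs"
    by (rule nth_equalityI) (auto simp: v_def)
  ultimately show ?thesis
    using atomic_embedding_eval_trm[OF h M, of v "App g (map Var [0..<length xs])"] assms(3)
    by (simp add: comp_def) (metis (no_types, lifting) list.map_comp comp_apply map_eq_conv)
qed

lemma substruc_embedding_image:
  assumes h: "atomic_embedding L h M N" and "is_struc L M" "is_struc L N"
  shows "substruc L (induced N (h ` carrier M)) N"
proof (rule substruc_induced)
  show "h ` carrier M \<noteq> {}" "h ` carrier M \<subseteq> carrier N"
    using assms unfolding is_struc_def atomic_embedding_def by auto
  fix g and xs
  assume g: "(g, length xs) \<in> funs L" and xs: "set xs \<subseteq> h ` carrier M"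
  obtain ys where ys: "xs = map h ys" "set ys \<subseteq> carrier M"
  proof -
    have "xs \<in> map h ` lists (carrier M)"
      using xs unfolding lists_image[symmetric] by auto
    then show thesis
      using that by auto
  qed
  then have "(g, length ys) \<in> funs L"
    using g by simp
  then have "fn M g ys \<in> carrier M"
    using assms(2) ys(2) unfolding is_struc_def by presburger
  then show "fn N g xs \<in> h ` carrier M"
    using atomic_embedding_fn[OF h assms(2) \<open>(g, length ys) \<in> funs L\<close> ys(2)] ys(1)
    by (metis imageI)
qed (fact assms)

lemma atomic_embedding_inverse:
  assumes h: "atomic_embedding L h M N" and "is_struc L M" "is_struc L N"
  shows "atomic_embedding L (inv_into (carrier M) h) (induced N (h ` carrier M)) M"
  unfolding atomic_embedding_def
proof (intro conjI allI impI)
  show "inj_on (inv_into (carrier M) h) (carrier (induced N (h ` carrier M)))"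
    by (simp add: inj_on_inv_into)
  show "inv_into (carrier M) h ` carrier (induced N (h ` carrier M)) \<subseteq> carrier M"
    by (auto simp: inv_into_into)
  fix \<phi> and v :: "nat \<Rightarrow> 'a"
  assume \<phi>: "atomic \<phi>" "wf_fm L \<phi>" and "range v \<subseteq> carrier (induced N (h ` carrier M))"
  then have v: "range v \<subseteq> h ` carrier M"
    by simp
  have v': "v k \<in> h ` carrier M" for k
    using v by blast
  then have "h \<circ> (inv_into (carrier M) h \<circ> v) = v"
    by (simp add: fun_eq_iff f_inv_into_f)
  moreover have "range (inv_into (carrier M) h \<circ> v) \<subseteq> carrier M"
    using v' by (auto intro: inv_into_into)
  ultimately have "sat M (inv_into (carrier M) h \<circ> v) \<phi> = sat N v \<phi>"
    using atomic_embeddingD(3)[OF h \<phi>, of "inv_into (carrier M) h \<circ> v"] by simp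
  then show "sat (induced N (h ` carrier M)) v \<phi> = sat M (inv_into (carrier M) h \<circ> v) \<phi>"
    using sat_atomic_substruc[OF substruc_embedding_image[OF assms] _ \<phi>] v by simp
qed

lemma atomic_embedding_comp:
  assumes "atomic_embedding L h M N" "atomic_embedding L h' N P"
  shows "atomic_embedding L (h' \<circ> h) M P"
proof -
  have h: "inj_on h (carrier M)" "h ` carrier M \<subseteq> carrier N"
    and h': "inj_on h' (carrier N)" "h' ` carrier N \<subseteq> carrier P"
    using assms by (simp_all only: atomic_embeddingD)
  have "sat M v \<phi> = sat P (h' \<circ> h \<circ> v) \<phi>"
    if "atomic \<phi>" "wf_fm L \<phi>" "range v \<subseteq> carrier M" for \<phi> and v :: "nat \<Rightarrow> 'a"
  proof -
    have "range (h \<circ> v) \<subseteq> carrier N"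
      using that(3) h(2) by auto
    then show ?thesis
      using atomic_embeddingD(3)[OF assms(1) that] atomic_embeddingD(3)[OF assms(2) that(1,2)]
      by (simp only: comp_assoc)
  qed
  moreover have "inj_on (h' \<circ> h) (carrier M)"
    using h h' by (meson comp_inj_on inj_on_subset)
  moreover have "(h' \<circ> h) ` carrier M \<subseteq> carrier P"
    using h h' by auto
  ultimately show ?thesis
    by (simp only: atomic_embedding_def) simp
qed

lemma substruc_antisym: "substruc L M N \<Longrightarrow> substruc L N M \<Longrightarrow> M = N"
proof -
  assume "substruc L M N" "substruc L N M"
  then have "carrier M = carrier N" "substruc L N N"
    unfolding substruc_def by auto
  then show "M = N"
    using \<open>substruc L M N\<close> induced_substruc by metis
qed

lemma substruc_trans: "substruc L M N \<Longrightarrow> substruc L N P \<Longrightarrow> substruc L M P"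
proof -
  assume MN: "substruc L M N" and NP: "substruc L N P"
  have sub: "set xs \<subseteq> carrier M \<Longrightarrow> set xs \<subseteq> carrier N" for xs
    using MN unfolding substruc_def by (meson subset_trans)
  have "fn M g xs = fn P g xs" if "(g, length xs) \<in> funs L" "set xs \<subseteq> carrier M" for g xs
    using MN NP that sub[OF that(2)] unfolding substruc_def by metis
  moreover have "rl M r xs = rl P r xs" if "(r, length xs) \<in> rels L" "set xs \<subseteq> carrier M" for r xs
    using MN NP that sub[OF that(2)] unfolding substruc_def by metis
  ultimately show "substruc L M P"
    using MN NP unfolding substruc_def by (metis subset_trans)
qed

text \<open>
  This makes the facts on types in abstract classes available for the types of \<open>EM(I, \<Phi>)\<close>
  and of its reducts, not only for those of the index structures.
\<close>

lemma abstract_class_all_strucs: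
  assumes "is_lang L"
  shows "abstract_class (all_strucs L)"
proof -
  have "partial_order_on {M. is_struc L M} {(M, N). substruc L M N}"
    unfolding partial_order_on_def preorder_on_def
  proof (intro conjI)
    show "{(M, N). substruc L M N} \<subseteq> {M. is_struc L M} \<times> {M. is_struc L M}"
      by (auto simp: substruc_def)
    show "refl_on {M. is_struc L M} {(M, N). substruc L M N}"
      unfolding refl_on_def using substruc_refl by blast
    show "trans {(M, N). substruc L M N}"
      unfolding trans_def using substruc_trans by blast
    show "antisym {(M, N). substruc L M N}"
      unfolding antisym_def using substruc_antisym by blast
  qed
  moreover have "substruc L (induced N' (h ` carrier M)) N'"
    if "substruc L M N" "isomorphism L h N N'" for M N N' h
  proof (rule substruc_embedding_image)
    show "atomic_embedding L h M N'"
      using atomic_embedding_comp[OF atomic_embedding_id[OF that(1)], of h N'] that(2)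
      by (simp add: isomorphism_def)
  qed (use that in \<open>simp_all add: isomorphism_def substruc_def\<close>)
  ultimately show ?thesis
    using assms unfolding abstract_class_def all_strucs_def
    by (simp add: isomorphism_def split_beta) (auto simp: substruc_def)
qed

section \<open>Types in abstract classes\<close>

text \<open>
  The equivalence of tuples is the reflexive transitive closure of this relation.
\<close>

definition type_step :: "'u abs_class \<Rightarrow> (('u struc \<times> 'u list) \<times> ('u struc \<times> 'u list)) set" where
  "type_step K = {((I, a), (I', a')). I \<in> members K \<and> I' \<in> members K \<and>
     set a \<subseteq> carrier I \<and> set a' \<subseteq> carrier I' \<and>
     (\<exists>J h. (I, J) \<in> leq K \<and> K_embedding K h I' J \<and> a = map h a')}"

lemma abstract_classD:
  assumes "abstract_class K"
  shows "I \<in> members K \<Longrightarrow> is_struc (lang_of K) I"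
    and "(I, J) \<in> leq K \<Longrightarrow> I \<in> members K \<and> J \<in> members K \<and> substruc (lang_of K) I J"
    and "I \<in> members K \<Longrightarrow> (I, I) \<in> leq K"
  using assms unfolding abstract_class_def partial_order_on_def preorder_on_def refl_on_def
  by auto

lemma K_embedding_id:
  assumes "abstract_class K" "(I, J) \<in> leq K"
  shows "K_embedding K id I J"
  using abstract_classD(2)[OF assms] assms(2) atomic_embedding_id induced_substruc
  unfolding K_embedding_def by (metis image_id id_apply)

lemma same_type_iff_steps:
  assumes K: "abstract_class K" and I: "I \<in> members K" "set a \<subseteq> carrier I"
  shows "same_type K I a J b \<longleftrightarrow> ((I, a), (J, b)) \<in> (type_step K)\<^sup>*"
proof
  assume "same_type K I a J b"
  then obtain n :: nat and J' I' b' h where ends: "I' 1 = I" "I' (n + 1) = J" "b' 1 = a" "b' (n + 1) = b"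
    and mem: "\<forall>l\<in>{1..n + 1}. I' l \<in> members K \<and> set (b' l) \<subseteq> carrier (I' l)"
    and emb: "\<forall>l\<in>{1..n}. J' l \<in> members K \<and> (I' l, J' l) \<in> leq K \<and>
           K_embedding K (h l) (I' (l + 1)) (J' l) \<and> b' l = map (h l) (b' (l + 1))"
    unfolding same_type_def by blast
  have "l \<le> n \<Longrightarrow> ((I' 1, b' 1), (I' (l + 1), b' (l + 1))) \<in> (type_step K)\<^sup>*" for l
  proof (induction l)
    case (Suc l)
    have "((I' (l + 1), b' (l + 1)), (I' (Suc l + 1), b' (Suc l + 1))) \<in> type_step K"
      using bspec[OF mem, of "Suc l"] bspec[OF mem, of "Suc (Suc l)"] bspec[OF emb, of "Suc l"] Suc.prems
      unfolding type_step_def by auto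
    then show ?case
      using Suc by (meson Suc_leD rtrancl.rtrancl_into_rtrancl)
  qed simp
  then show "((I, a), (J, b)) \<in> (type_step K)\<^sup>*"
    using ends by (metis order_refl)
next
  assume "((I, a), (J, b)) \<in> (type_step K)\<^sup>*"
  then obtain n where "((I, a), (J, b)) \<in> type_step K ^^ n"
    by (auto simp: rtrancl_power)
  then obtain c where c: "c 0 = (I, a)" "c n = (J, b)"
    and step: "\<And>i. i < n \<Longrightarrow> (c i, c (Suc i)) \<in> type_step K"
    unfolding relpow_fun_conv by blast
  define I' where "I' l = fst (c (l - 1))" for l
  define b' where "b' l = snd (c (l - 1))" for l
  have "\<forall>l. \<exists>J h. l \<in> {1..n} \<longrightarrow> (I' l, J) \<in> leq K \<and> K_embedding K h (I' (l + 1)) J \<and>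
      b' l = map h (b' (l + 1))"
  proof
    fix l
    show "\<exists>J h. l \<in> {1..n} \<longrightarrow> (I' l, J) \<in> leq K \<and> K_embedding K h (I' (l + 1)) J \<and>
      b' l = map h (b' (l + 1))"
      using step[of "l - 1"] unfolding type_step_def I'_def b'_def by fastforce
  qed
  then obtain J' h where emb: "\<And>l. l \<in> {1..n} \<Longrightarrow> (I' l, J' l) \<in> leq K \<and>
      K_embedding K (h l) (I' (l + 1)) (J' l) \<and> b' l = map (h l) (b' (l + 1))"
    by metis
  have mem: "I' l \<in> members K \<and> set (b' l) \<subseteq> carrier (I' l)" if l: "l \<in> {1..n + 1}" for l
  proof (cases "l = 1")
    case True
    then show ?thesis
      using I c by (simp add: I'_def b'_def)
  next
    case False
    then have "l - 1 = Suc (l - 2)" "l - 2 < n"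
      using l by auto
    then show ?thesis
      using step[of "l - 2"] unfolding type_step_def I'_def b'_def by auto
  qed
  have "I' 1 = I \<and> I' (n + 1) = J \<and> b' 1 = a \<and> b' (n + 1) = b"
    using c by (simp add: I'_def b'_def)
  moreover have "J' l \<in> members K" if "l \<in> {1..n}" for l
    using emb[OF that] abstract_classD(2)[OF K] by blast
  ultimately show "same_type K I a J b"
    unfolding same_type_def using mem emb by blast
qed

text \<open>
  A step from \<open>(I, a)\<close> to \<open>(I', a')\<close> through \<open>J \<ge> I\<close> and \<open>h : I' \<rightarrow> J\<close> is undone by two steps:
  from \<open>I'\<close> to its image in \<open>J\<close> along the inverse of \<open>h\<close>, and from there to \<open>I\<close>, which both
  lie in \<open>J\<close>.
\<close>

lemma type_step_reverse:
  assumes K: "abstract_class K" and "(x, y) \<in> type_step K"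
  shows "(y, x) \<in> (type_step K)\<^sup>*"
proof -
  obtain I a I' a' J h where xy: "x = (I, a)" "y = (I', a')"
    and mem: "I \<in> members K" "I' \<in> members K" "set a \<subseteq> carrier I" "set a' \<subseteq> carrier I'"
    and J: "(I, J) \<in> leq K" and h: "K_embedding K h I' J" and a: "a = map h a'"
    using assms(2) unfolding type_step_def by blast
  define H where "H = induced J (h ` carrier I')"
  define g where "g = inv_into (carrier I') h"
  have HJ: "(H, J) \<in> leq K" and emb: "atomic_embedding (lang_of K) h I' J"
    using h unfolding K_embedding_def H_def by auto
  then have H: "H \<in> members K"
    using abstract_classD(2)[OF K] by blast
  have inj: "inj_on h (carrier I')"
    by (rule atomic_embeddingD(1)[OF emb])
  have a'_eq: "a' = map g a"
    using a mem(4) inj by (simp add: g_def map_idI subset_iff)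
  have "atomic_embedding (lang_of K) g H I'"
    using abstract_classD(1,2)[OF K] mem(2) J emb unfolding H_def g_def
    by (intro atomic_embedding_inverse) auto
  moreover have "g ` carrier H = carrier I'"
    using inj unfolding H_def g_def by (force simp: image_image)
  then have "induced I' (g ` carrier H) = I'"
    using induced_substruc[OF substruc_refl] abstract_classD(1)[OF K mem(2)] by metis
  ultimately have "K_embedding K g H I'"
    using abstract_classD(3)[OF K mem(2)] unfolding K_embedding_def by simp
  moreover have aH: "set a \<subseteq> carrier H"
    using a mem(4) unfolding H_def by auto
  ultimately have "((I', a'), (H, a)) \<in> type_step K"
    using mem H abstract_classD(3)[OF K mem(2)] a'_eq unfolding type_step_def by blast
  moreover have "((H, a), (I, a)) \<in> type_step K"
    using mem H HJ aH K_embedding_id[OF K J] unfolding type_step_def by force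
  ultimately show ?thesis
    unfolding xy by (meson rtrancl.simps)
qed

lemma type_step_leq:
  assumes K: "abstract_class K" and "(I, J) \<in> leq K" "set a \<subseteq> carrier I"
  shows "((I, a), (J, a)) \<in> type_step K"
proof -
  have "I \<in> members K" "J \<in> members K" "carrier I \<subseteq> carrier J"
    using abstract_classD(2)[OF K assms(2)] by (auto simp: substruc_def)
  moreover have "K_embedding K id J J"
    using K_embedding_id[OF K] abstract_classD(3)[OF K] calculation(2) by blast
  moreover have "a = map id a"
    by simp
  ultimately show ?thesis
    using assms(2,3) unfolding type_step_def by blast
qed

lemma type_steps_sym:
  assumes K: "abstract_class K" and "(x, y) \<in> (type_step K)\<^sup>*"
  shows "(y, x) \<in> (type_step K)\<^sup>*"
  using assms(2)
proof (induction rule: rtrancl_induct)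
  case (step y z)
  then show ?case
    using type_step_reverse[OF K] by (meson rtrancl_trans)
qed simp

lemma type_steps_members:
  assumes "((I, a), (J, b)) \<in> (type_step K)\<^sup>*" "I \<in> members K" "set a \<subseteq> carrier I"
  shows "J \<in> members K" "set b \<subseteq> carrier J"
  using assms by (induction rule: rtrancl_induct2) (auto simp: type_step_def)

lemma type_steps_length: "((I, a), (J, b)) \<in> (type_step K)\<^sup>* \<Longrightarrow> length b = length a"
  by (induction rule: rtrancl_induct2) (auto simp: type_step_def)

lemma type_steps_nths:
  assumes "((I, a), (J, b)) \<in> (type_step K)\<^sup>*"
  shows "((I, nths a s), (J, nths b s)) \<in> (type_step K)\<^sup>*"
  using assms
proof (induction rule: rtrancl_induct2)
  case (step J b J' b')
  obtain N h where "J \<in> members K" "J' \<in> members K" "set b \<subseteq> carrier J" "set b' \<subseteq> carrier J'"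
    "(J, N) \<in> leq K" "K_embedding K h J' N" "b = map h b'"
    using step(2) unfolding type_step_def by auto
  moreover from this have "set (nths b s) \<subseteq> carrier J" "set (nths b' s) \<subseteq> carrier J'"
    using set_nths_subset subset_trans by metis+
  ultimately have "((J, nths b s), (J', nths b' s)) \<in> type_step K"
    unfolding type_step_def using nths_map[of h b' s] by blast
  then show ?case
    using step(3) by (rule rtrancl.rtrancl_into_rtrancl[rotated])
qed simp

lemma tp_eq_steps:
  assumes "abstract_class K" "I \<in> members K" "set a \<subseteq> carrier I"
  shows "tp K I a = {(J, b). ((I, a), (J, b)) \<in> (type_step K)\<^sup>*}"
  using same_type_iff_steps[OF assms] type_steps_members[OF _ assms(2,3)]
  unfolding tp_def by blast

lemma tp_eq_iff_steps:
  assumes K: "abstract_class K" and I: "I \<in> members K" "set a \<subseteq> carrier I"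
    and J: "J \<in> members K" "set b \<subseteq> carrier J"
  shows "tp K I a = tp K J b \<longleftrightarrow> ((I, a), (J, b)) \<in> (type_step K)\<^sup>*"
proof
  assume "tp K I a = tp K J b"
  then have "(J, b) \<in> tp K I a"
    by (simp add: tp_eq_steps[OF K J])
  then show "((I, a), (J, b)) \<in> (type_step K)\<^sup>*"
    by (simp add: tp_eq_steps[OF K I])
next
  assume *: "((I, a), (J, b)) \<in> (type_step K)\<^sup>*"
  show "tp K I a = tp K J b"
    unfolding tp_eq_steps[OF K I] tp_eq_steps[OF K J]
    using * type_steps_sym[OF K *] by (auto intro: rtrancl_trans)
qed

lemma tp_eq_length:
  assumes "abstract_class K" "I \<in> members K" "set a \<subseteq> carrier I" "J \<in> members K" "set b \<subseteq> carrier J"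
    and "tp K I a = tp K J b"
  shows "length b = length a"
  using assms(6) type_steps_length unfolding tp_eq_iff_steps[OF assms(1-5)] by blast

text \<open>
  The union that defines the restricted type is over representatives that all contribute the
  same type, because a chain of steps restricts to a chain between the subtuples.
\<close>

lemma type_at_tp:
  assumes K: "abstract_class K" and I: "I \<in> members K" "set a \<subseteq> carrier I"
  shows "type_at K (tp K I a) s = tp K I (nths a s)"
proof -
  have same: "tp K J (nths b s) = tp K I (nths a s)" if "(J, b) \<in> tp K I a" for J b
  proof -
    have steps: "((I, a), (J, b)) \<in> (type_step K)\<^sup>*"
      using that by (simp add: tp_eq_steps[OF K I])
    have "set (nths a s) \<subseteq> carrier I" "set (nths b s) \<subseteq> carrier J"
      using set_nths_subset I(2) type_steps_members[OF steps I] by fastforce+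
    then show ?thesis
      using tp_eq_iff_steps[OF K I(1) _ type_steps_members(1)[OF steps I]] type_steps_nths[OF steps]
      by metis
  qed
  have "(I, a) \<in> tp K I a"
    by (simp add: tp_eq_steps[OF K I])
  then show ?thesis
    unfolding type_at_def
  proof (intro SUP_eq_const)
    fix x
    assume "x \<in> tp K I a"
    then show "(case x of (J, b) \<Rightarrow> tp K J (nths b s)) = tp K I (nths a s)"
      using same[of "fst x" "snd x"] by (simp only: split_beta prod.collapse)
  qed blast
qed

lemma all_strucs_simps [simp]:
  "lang_of (all_strucs L) = L"
  "M \<in> members (all_strucs L) \<longleftrightarrow> is_struc L M"
  "(M, N) \<in> leq (all_strucs L) \<longleftrightarrow> substruc L M N"
  by (simp_all add: all_strucs_def)

lemma type_steps_reduct: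
  assumes L: "sublang L L'" and "((M, a), (N, b)) \<in> (type_step (all_strucs L'))\<^sup>*"
  shows "((reduct L M, a), (reduct L N, b)) \<in> (type_step (all_strucs L))\<^sup>*"
  using assms(2)
proof (induction rule: rtrancl_induct2)
  case (step N b N' b')
  then obtain J h where mem: "is_struc L' N" "is_struc L' N'" "set b \<subseteq> carrier N" "set b' \<subseteq> carrier N'"
    and J: "substruc L' N J" and h: "K_embedding (all_strucs L') h N' J" and b: "b = map h b'"
    unfolding type_step_def by auto
  have emb: "atomic_embedding L' h N' J" and HJ: "substruc L' (induced J (h ` carrier N')) J"
    using h by (auto simp: K_embedding_def)
  have "atomic_embedding L h (reduct L N') (reduct L J)"
    using atomic_embeddingD[OF emb] wf_fm_mono[OF L]
    by (simp add: atomic_embedding_def sat_reduct)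
  then have "K_embedding (all_strucs L) h (reduct L N') (reduct L J)"
    using substruc_reduct[OF HJ L] by (simp add: K_embedding_def reduct_induced)
  then have "((reduct L N, b), (reduct L N', b')) \<in> type_step (all_strucs L)"
    using mem substruc_reduct[OF J L] b is_struc_reduct[OF _ L] unfolding type_step_def by auto
  then show ?case
    using step(3) by (rule rtrancl.rtrancl_into_rtrancl[rotated])
qed simp

text \<open>
  Here the union collapses because the reduct of a chain of steps is again a chain of steps.
\<close>

lemma type_reduct_tp:
  assumes "is_lang L" "is_lang L'" "sublang L L'" "is_struc L' M" "set a \<subseteq> carrier M"
  shows "type_reduct L (tp (all_strucs L') M a) = tp (all_strucs L) (reduct L M) a"
proof -
  note L = abstract_class_all_strucs[OF assms(1)] and L' = abstract_class_all_strucs[OF assms(2)]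
  have same: "tp (all_strucs L) (reduct L N) b = tp (all_strucs L) (reduct L M) a"
    if "(N, b) \<in> tp (all_strucs L') M a" for N b
  proof -
    have steps: "((M, a), (N, b)) \<in> (type_step (all_strucs L'))\<^sup>*"
      using that assms tp_eq_steps[OF L'] by simp
    then show ?thesis
      using type_steps_members[OF steps] type_steps_reduct[OF assms(3) steps] assms(4,5)
        is_struc_reduct[OF _ assms(3)] tp_eq_iff_steps[OF L, of "reduct L M" a "reduct L N" b]
      by simp
  qed
  have "(M, a) \<in> tp (all_strucs L') M a"
    using assms tp_eq_steps[OF L'] by simp
  then show ?thesis
    unfolding type_reduct_def
  proof (intro SUP_eq_const)
    fix x
    assume "x \<in> tp (all_strucs L') M a"
    then show "(case x of (N, b) \<Rightarrow> tp (all_strucs L) (reduct L N) b) =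
        tp (all_strucs L) (reduct L M) a"
      using same[of "fst x" "snd x"] by (simp only: split_beta prod.collapse)
  qed blast
qed

section \<open>Types in the class of all structures are quantifier-free types\<close>

text \<open>
  Valuations take the place of tuples, so that the values of terms form a valuation again and
  the relation is closed under substitution.  A nonempty tuple \<open>a\<close> enters as a valuation
  \<open>\<lambda>k. a ! \<rho> k\<close> that repeats some of its entries.
\<close>

definition same_atomic :: "'u lang \<Rightarrow> 'u struc \<Rightarrow> (nat \<Rightarrow> 'u) \<Rightarrow> 'u struc \<Rightarrow> (nat \<Rightarrow> 'u) \<Rightarrow> bool" where
  "same_atomic L M v N w \<longleftrightarrow> (\<forall>\<phi>. atomic \<phi> \<longrightarrow> wf_fm L \<phi> \<longrightarrow> sat M v \<phi> = sat N w \<phi>)"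

lemma same_atomicD:
  "same_atomic L M v N w \<Longrightarrow> atomic \<phi> \<Longrightarrow> wf_fm L \<phi> \<Longrightarrow> sat M v \<phi> = sat N w \<phi>"
  by (simp only: same_atomic_def)

lemma same_atomic_trans:
  "same_atomic L M v N w \<Longrightarrow> same_atomic L N w P u \<Longrightarrow> same_atomic L M v P u"
  by (simp add: same_atomic_def)

lemma same_atomic_subst:
  assumes "same_atomic L M v N w" "\<And>k. wf_trm L (s k)"
  shows "same_atomic L M (\<lambda>k. eval_trm M v (s k)) N (\<lambda>k. eval_trm N w (s k))"
  unfolding same_atomic_def
proof (intro allI impI)
  fix \<phi> :: "'a fm"
  assume \<phi>: "atomic \<phi>" "wf_fm L \<phi>"
  show "sat M (\<lambda>k. eval_trm M v (s k)) \<phi> = sat N (\<lambda>k. eval_trm N w (s k)) \<phi>"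
  proof (cases \<phi>)
    case (Eq t t')
    then show ?thesis
      using \<phi> same_atomicD[OF assms(1), of "Eq (subst_trm s t) (subst_trm s t')"] assms(2)
      by (simp add: eval_subst_trm wf_subst_trm)
  next
    case (Rel r ts)
    have "map (eval_trm M v) (map (subst_trm s) ts) = map (eval_trm M (\<lambda>k. eval_trm M v (s k))) ts"
      "map (eval_trm N w) (map (subst_trm s) ts) = map (eval_trm N (\<lambda>k. eval_trm N w (s k))) ts"
      by (simp_all add: eval_subst_trm)
    moreover have "wf_fm L (Rel r (map (subst_trm s) ts))"
      using \<phi> Rel assms(2) by (simp add: wf_subst_trm)
    ultimately show ?thesis
      using same_atomicD[OF assms(1), of "Rel r (map (subst_trm s) ts)"] Rel
      by (simp only: sat.simps atomic.simps)
  qed (use \<phi> in auto)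
qed

lemma same_atomic_if_type_steps:
  assumes "((M, a), (N, b)) \<in> (type_step (all_strucs L))\<^sup>*" and \<rho>: "\<And>k. \<rho> k < length a"
  shows "same_atomic L M (\<lambda>k. a ! \<rho> k) N (\<lambda>k. b ! \<rho> k)"
  using assms(1)
proof (induction rule: rtrancl_induct2)
  case refl
  then show ?case
    by (simp add: same_atomic_def)
next
  case (step N b N' b')
  then obtain J h where mem: "is_struc L N" "is_struc L N'" "set b \<subseteq> carrier N" "set b' \<subseteq> carrier N'"
    and J: "substruc L N J" and h: "K_embedding (all_strucs L) h N' J" and b: "b = map h b'"
    unfolding type_step_def by auto
  have emb: "atomic_embedding L h N' J"
    using h by (auto simp: K_embedding_def)
  have "length b = length a" "length b' = length a"
    using type_steps_length step(1) b by fastforce+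
  then have ranges: "range (\<lambda>k. b ! \<rho> k) \<subseteq> carrier N" "range (\<lambda>k. b' ! \<rho> k) \<subseteq> carrier N'"
    and "h \<circ> (\<lambda>k. b' ! \<rho> k) = (\<lambda>k. b ! \<rho> k)"
    using mem(3,4) \<rho> b nth_mem[of _ b] nth_mem[of _ b'] by (auto simp: subset_iff)
  then have "same_atomic L N (\<lambda>k. b ! \<rho> k) N' (\<lambda>k. b' ! \<rho> k)"
    using sat_atomic_substruc[OF J ranges(1)] atomic_embeddingD(3)[OF emb _ _ ranges(2)]
    by (simp add: same_atomic_def)
  then show ?case
    using step(3) same_atomic_trans by blast
qed

definition generated :: "'u lang \<Rightarrow> 'u struc \<Rightarrow> (nat \<Rightarrow> 'u) \<Rightarrow> 'u struc" where
  "generated L M v = induced M {eval_trm M v t | t. wf_trm L t}"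

lemma generated_substruc:
  assumes "is_struc L M" "range v \<subseteq> carrier M"
  shows "substruc L (generated L M v) M"
  unfolding generated_def
proof (rule substruc_induced)
  show "{eval_trm M v t |t. wf_trm L t} \<subseteq> carrier M"
    using eval_trm_in_carrier[OF assms] by auto
  show "{eval_trm M v t |t. wf_trm L t} \<noteq> {}"
    using wf_trm.simps(1)[of L 0] by blast
  fix g and xs
  assume g: "(g, length xs) \<in> funs L" and "set xs \<subseteq> {eval_trm M v t |t. wf_trm L t}"
  then have "\<forall>x\<in>set xs. \<exists>t. wf_trm L t \<and> x = eval_trm M v t"
    by blast
  then obtain t where t: "\<And>x. x \<in> set xs \<Longrightarrow> wf_trm L (t x) \<and> x = eval_trm M v (t x)"
    by metis
  then have "map (eval_trm M v) (map t xs) = xs"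
    by (simp add: map_idI)
  then have "fn M g xs = eval_trm M v (App g (map t xs))"
    by (simp only: eval_trm.simps)
  moreover have "wf_trm L (App g (map t xs))"
    using g t by simp
  ultimately show "fn M g xs \<in> {eval_trm M v t |t. wf_trm L t}"
    by blast
qed (fact assms)

lemma range_generated: "range v \<subseteq> carrier (generated L M v)"
proof
  fix x
  assume "x \<in> range v"
  then obtain k where "x = eval_trm M v (Var k)"
    by auto
  moreover have "wf_trm L (Var k)"
    by simp
  ultimately show "x \<in> carrier (generated L M v)"
    unfolding generated_def carrier_induced by blast
qed

text \<open>
  Two valuations that satisfy the same atomic formulas generate isomorphic substructures, and
  these are linked by a step in each direction with the structures that contain them.  That
  the chain passes through the generated substructures avoids an amalgamation of \<open>M\<close> and \<open>N\<close>.
\<close>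

lemma type_steps_if_same_atomic:
  assumes M: "is_struc L M" "range v \<subseteq> carrier M" and N: "is_struc L N" "range w \<subseteq> carrier N"
    and same: "same_atomic L M v N w" and L: "is_lang L"
  shows "((M, map v ks), (N, map w ks)) \<in> (type_step (all_strucs L))\<^sup>*"
proof -
  let ?A = "generated L M v" and ?B = "generated L N w"
  note subA = generated_substruc[OF M] and subB = generated_substruc[OF N]
  have strucs: "is_struc L ?A" "is_struc L ?B"
    using subA subB by (simp_all add: substruc_def)
  have eq: "eval_trm M v t = eval_trm M v t' \<longleftrightarrow> eval_trm N w t = eval_trm N w t'"
    if "wf_trm L t" "wf_trm L t'" for t t'
    using same_atomicD[OF same, of "Eq t t'"] that by simp
  define h where "h y = eval_trm M v (SOME t. wf_trm L t \<and> y = eval_trm N w t)" for y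
  have h: "h (eval_trm N w t) = eval_trm M v t" if "wf_trm L t" for t
    unfolding h_def using someI[of "\<lambda>s. wf_trm L s \<and> eval_trm N w t = eval_trm N w s" t] that eq
    by auto
  have h_image: "h ` carrier ?B = carrier ?A"
    unfolding generated_def carrier_induced using h by (auto simp: image_iff) metis
  have "inj_on h (carrier ?B)"
    unfolding generated_def carrier_induced using h eq by (auto simp: inj_on_def)
  moreover have "sat ?B u \<phi> = sat ?A (h \<circ> u) \<phi>"
    if \<phi>: "atomic \<phi>" "wf_fm L \<phi>" and u: "range u \<subseteq> carrier ?B" for \<phi> u
  proof -
    have "\<exists>t. wf_trm L t \<and> u k = eval_trm N w t" for k
      using u unfolding generated_def carrier_induced by blast
    then obtain t where t: "\<And>k. wf_trm L (t k)" and "\<And>k. u k = eval_trm N w (t k)"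
      by metis
    then have u_eq: "u = (\<lambda>k. eval_trm N w (t k))" and "h \<circ> u = (\<lambda>k. eval_trm M v (t k))"
      using h by auto
    then have "sat N u \<phi> = sat M (h \<circ> u) \<phi>"
      using same_atomicD[OF same_atomic_subst[OF same t] \<phi>] by simp
    moreover have "range (h \<circ> u) \<subseteq> carrier ?A"
      using u h_image by auto
    ultimately show ?thesis
      using sat_atomic_substruc[OF subA _ \<phi>] sat_atomic_substruc[OF subB u \<phi>] by simp
  qed
  ultimately have "atomic_embedding L h ?B ?A"
    using h_image by (simp add: atomic_embedding_def)
  then have emb: "K_embedding (all_strucs L) h ?B ?A"
    using h_image induced_substruc[OF substruc_refl[OF strucs(1)]] strucs
    by (simp add: K_embedding_def substruc_refl)
  have lists: "set (map v ks) \<subseteq> carrier ?A" "set (map w ks) \<subseteq> carrier ?B"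
    "set (map v ks) \<subseteq> carrier M" "set (map w ks) \<subseteq> carrier N"
    using range_generated[of v L M] range_generated[of w L N] M N by auto
  have "h (w k) = v k" for k
    using h[of "Var k"] by simp
  then have "map v ks = map h (map w ks)"
    by simp
  then have AB: "((?A, map v ks), (?B, map w ks)) \<in> type_step (all_strucs L)"
    using strucs lists emb substruc_refl[OF strucs(1)] unfolding type_step_def by fastforce
  have BN: "((?B, map w ks), (N, map w ks)) \<in> type_step (all_strucs L)"
    and AM: "((?A, map v ks), (M, map v ks)) \<in> type_step (all_strucs L)"
    using type_step_leq[OF abstract_class_all_strucs[OF L]] lists subA subB by simp_all
  have "((M, map v ks), (?A, map v ks)) \<in> (type_step (all_strucs L))\<^sup>*"
    by (rule type_step_reverse[OF abstract_class_all_strucs[OF L] AM])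
  then show ?thesis
    using AB BN by (meson rtrancl.rtrancl_into_rtrancl)
qed

section \<open>Skolem functions\<close>

text \<open>
  These are the free variables of \<open>\<exists>k. \<phi>\<close>.  Since \<open>k\<close> is not among them, the value of the Skolem
  term does not change when \<open>k\<close> is assigned a witness.
\<close>

definition skolem_args :: "nat \<Rightarrow> 'u fm \<Rightarrow> nat list" where
  "skolem_args k \<phi> = sorted_list_of_set (fv_fm \<phi> - {k})"

lemma set_skolem_args [simp]: "set (skolem_args k \<phi>) = fv_fm \<phi> - {k}"
  by (simp add: skolem_args_def)

text \<open>
  Only the formulas of \<open>L\<close> get Skolem functions.  One round of them suffices, since only the
  formulas of \<open>L\<close> are to be transferred.
\<close>

definition skolem_lang :: "'u lang \<Rightarrow> (nat \<times> 'u fm \<Rightarrow> 'u) \<Rightarrow> 'u lang" where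
  "skolem_lang L sk = \<lparr>funs = funs L \<union> {(sk (k, \<phi>), length (skolem_args k \<phi>)) | k \<phi>. wf_fm L \<phi>},
     rels = rels L\<rparr>"

definition skolem_names :: "'u lang \<Rightarrow> (nat \<times> 'u fm \<Rightarrow> 'u) \<Rightarrow> bool" where
  "skolem_names L sk \<longleftrightarrow> inj_on sk {(k, \<phi>). wf_fm L \<phi>} \<and>
     sk ` {(k, \<phi>). wf_fm L \<phi>} \<inter> fst ` funs L = {}"

text \<open>
  Under this condition, the substructures for the larger language are elementary substructures
  for \<open>L\<close>, by the criterion of Tarski and Vaught.
\<close>

definition has_skolem_functions :: "'u lang \<Rightarrow> (nat \<times> 'u fm \<Rightarrow> 'u) \<Rightarrow> 'u struc \<Rightarrow> bool" where
  "has_skolem_functions L sk M \<longleftrightarrow>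
     (\<forall>k \<phi> v. wf_fm L \<phi> \<longrightarrow> range v \<subseteq> carrier M \<longrightarrow> sat M v (Ex k \<phi>) \<longrightarrow>
        sat M (v(k := fn M (sk (k, \<phi>)) (map v (skolem_args k \<phi>)))) \<phi>)"

lemma sublang_skolem_lang: "sublang L (skolem_lang L sk)"
  by (auto simp: sublang_def skolem_lang_def)

text \<open>
  Whether an element is a witness for \<open>\<exists>k. \<phi>\<close> depends only on the values of the other free
  variables of \<open>\<phi>\<close>, so a choice of witnesses is a function of these values.
\<close>

lemma skolem_expansion_exists:
  assumes M: "is_struc L M" and sk: "skolem_names L sk"
  shows "\<exists>M'. expansion L M (skolem_lang L sk) M' \<and> has_skolem_functions L sk M'"
proof -
  obtain c where c: "c \<in> carrier M"
    using M unfolding is_struc_def by blast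
  have "\<exists>y\<in>carrier M. \<forall>z\<in>carrier M. \<forall>v. map v (skolem_args k \<phi>) = xs \<longrightarrow>
      sat M (v(k := z)) \<phi> \<longrightarrow> sat M (v(k := y)) \<phi>" for k \<phi> xs
  proof (cases "\<exists>z\<in>carrier M. \<exists>v. map v (skolem_args k \<phi>) = xs \<and> sat M (v(k := z)) \<phi>")
    case True
    then obtain y u where y: "y \<in> carrier M" "map u (skolem_args k \<phi>) = xs" "sat M (u(k := y)) \<phi>"
      by blast
    have "sat M (v(k := y)) \<phi>" if "map v (skolem_args k \<phi>) = xs" for v
    proof -
      have "\<forall>j\<in>fv_fm \<phi> - {k}. v j = u j"
        using that y(2) by (metis map_eq_conv set_skolem_args)
      then have "sat M (v(k := y)) \<phi> = sat M (u(k := y)) \<phi>"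
        by (intro sat_cong) auto
      then show ?thesis
        using y(3) by simp
    qed
    then show ?thesis
      using y(1) by blast
  next
    case False
    then show ?thesis
      using c by blast
  qed
  then obtain w where w: "\<And>k \<phi> xs. w k \<phi> xs \<in> carrier M"
    and wit: "\<And>k \<phi> z v. z \<in> carrier M \<Longrightarrow> sat M (v(k := z)) \<phi> \<Longrightarrow>
      sat M (v(k := w k \<phi> (map v (skolem_args k \<phi>)))) \<phi>"
    by metis
  define sk' where "sk' = inv_into {(k, \<phi>). wf_fm L \<phi>} sk"
  define M' where "M' = \<lparr>carrier = carrier M,
    fn = (\<lambda>g xs. if (g, length xs) \<in> funs L then fn M g xs
       else if (g, length xs) \<in> funs (skolem_lang L sk) \<and> set xs \<subseteq> carrier M
       then w (fst (sk' g)) (snd (sk' g)) xs else undefined),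
    rl = rl M\<rparr>"
  have carrier: "carrier M' = carrier M"
    by (simp add: M'_def)
  have "reduct L M' = M"
  proof -
    have "(\<lambda>g xs. if (g, length xs) \<in> funs L then fn M' g xs else undefined) = fn M"
      using M unfolding is_struc_def by (intro ext) (auto simp: M'_def)
    moreover have "(\<lambda>r xs. (r, length xs) \<in> rels L \<and> rl M' r xs) = rl M"
      using M unfolding is_struc_def by (intro ext) (auto simp: M'_def)
    ultimately show ?thesis
      by (simp add: reduct_def carrier)
  qed
  moreover have "is_struc (skolem_lang L sk) M'"
    unfolding is_struc_def
  proof (intro conjI allI impI)
    show "carrier M' \<noteq> {}" "carrier M' \<prec> (UNIV :: 'a set)"
      using M unfolding is_struc_def by (simp_all add: carrier)
    fix g xs
    show "if (g, length xs) \<in> funs (skolem_lang L sk) \<and> set xs \<subseteq> carrier M'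
        then fn M' g xs \<in> carrier M' else fn M' g xs = undefined"
    proof (cases "(g, length xs) \<in> funs L")
      case True
      then have "fn M' g xs = fn M g xs" "(g, length xs) \<in> funs (skolem_lang L sk)"
        by (auto simp: M'_def skolem_lang_def)
      then show ?thesis
        using M True unfolding is_struc_def carrier by metis
    next
      case False
      then show ?thesis
        using w by (simp add: M'_def)
    qed
  next
    fix r xs
    assume "rl M' r xs"
    then show "(r, length xs) \<in> rels (skolem_lang L sk)" "set xs \<subseteq> carrier M'"
      using M unfolding is_struc_def by (auto simp: M'_def skolem_lang_def)
  qed
  moreover have "has_skolem_functions L sk M'"
    unfolding has_skolem_functions_def
  proof (intro allI impI)
    fix k \<phi> and v :: "nat \<Rightarrow> 'a"
    assume \<phi>: "wf_fm L \<phi>" and v: "range v \<subseteq> carrier M'" and "sat M' v (Ex k \<phi>)"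
    have sat_M': "sat M' u \<phi> = sat M u \<phi>" for u
      using sat_reduct[OF \<phi>, of M' u] \<open>reduct L M' = M\<close> by simp
    then obtain z where "z \<in> carrier M" "sat M (v(k := z)) \<phi>"
      using \<open>sat M' v (Ex k \<phi>)\<close> carrier by auto
    then have "sat M (v(k := w k \<phi> (map v (skolem_args k \<phi>)))) \<phi>"
      by (rule wit)
    moreover have "sk' (sk (k, \<phi>)) = (k, \<phi>)"
      using sk \<phi> unfolding sk'_def skolem_names_def by (intro inv_into_f_f) auto
    moreover have "(sk (k, \<phi>), n) \<notin> funs L" for n
      using sk \<phi> unfolding skolem_names_def by force
    moreover have "(sk (k, \<phi>), length (skolem_args k \<phi>)) \<in> funs (skolem_lang L sk)"
      using \<phi> by (auto simp: skolem_lang_def)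
    moreover have "set (map v (skolem_args k \<phi>)) \<subseteq> carrier M"
      using v carrier by auto
    ultimately show "sat M' (v(k := fn M' (sk (k, \<phi>)) (map v (skolem_args k \<phi>)))) \<phi>"
      unfolding sat_M' by (simp add: M'_def)
  qed
  ultimately show ?thesis
    using sublang_skolem_lang unfolding expansion_def by blast
qed

text \<open>
  There are no more formulas than symbols plus \<open>\<aleph>\<^sub>0\<close>, and removing the few names in use from
  the universe leaves enough names for the Skolem functions.
\<close>

lemma skolem_names_exist:
  assumes unc: "uncountable (UNIV :: 'u set)" and L: "is_lang (L :: 'u lang)"
  shows "\<exists>sk. skolem_names L sk \<and> is_lang (skolem_lang L sk) \<and>
    lang_card (skolem_lang L sk) \<le> lang_card L"
proof -
  let ?U = "UNIV :: 'u set"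
  define X where "X = funs L <+> rels L <+> (UNIV :: nat set)"
  have infU: "infinite ?U"
    using unc countable_finite by blast
  have X: "infinite X"
    by (simp add: X_def)
  have "(UNIV :: nat set) \<prec> ?U"
    by (rule nat_lesspoll_uncountable[OF unc])
  then have small: "X \<prec> ?U"
    using L infU unfolding X_def is_lang_def by (intro Plus_lesspoll) auto
  have funs: "funs L \<lesssim> X" and rels: "rels L \<lesssim> X" and nat: "(UNIV :: nat set) \<lesssim> X"
    unfolding X_def lepoll_def by (intro exI[of _ Inl] exI[of _ "Inr \<circ> Inl"] exI[of _ "Inr \<circ> Inr"]; auto simp: inj_on_def)+
  define P where "P = {(k :: nat, \<phi>). wf_fm L \<phi>}"
  have "fst ` funs L \<union> fst ` rels L \<lesssim> X"
    using funs rels X image_lepoll lepoll_trans by (intro Un_lepoll) blast+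
  then have "{\<phi>. set_fm \<phi> \<subseteq> fst ` funs L \<union> fst ` rels L} \<lesssim> X"
    by (rule formulas_lepoll[OF _ X])
  then have "(UNIV :: nat set) \<times> {\<phi>. set_fm \<phi> \<subseteq> fst ` funs L \<union> fst ` rels L} \<lesssim> X"
    using nat X by (intro Times_lepoll)
  moreover have "P \<subseteq> (UNIV :: nat set) \<times> {\<phi>. set_fm \<phi> \<subseteq> fst ` funs L \<union> fst ` rels L}"
    unfolding P_def using set_fm_wf by blast
  ultimately have P: "P \<lesssim> X"
    using subset_imp_lepoll lepoll_trans by blast
  have "fst ` funs L \<prec> ?U"
    using L image_lepoll lesspoll_trans1 unfolding is_lang_def by blast
  then have "?U \<lesssim> ?U - fst ` funs L"
    by (rule lepoll_complement[OF infU])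
  then have "P \<lesssim> ?U - fst ` funs L"
    using P small lesspoll_imp_lepoll lepoll_trans by meson
  then obtain sk where sk: "inj_on sk P" "sk ` P \<subseteq> ?U - fst ` funs L"
    unfolding lepoll_def by blast
  then have names: "skolem_names L sk"
    unfolding skolem_names_def P_def by blast
  have eq: "funs (skolem_lang L sk) = funs L \<union> (\<lambda>(k, \<phi>). (sk (k, \<phi>), length (skolem_args k \<phi>))) ` P"
    unfolding skolem_lang_def P_def by auto
  have funs': "funs (skolem_lang L sk) \<lesssim> X"
    unfolding eq using funs lepoll_trans[OF image_lepoll P] X by (rule Un_lepoll)
  have rels': "rels (skolem_lang L sk) \<lesssim> X"
    using rels by (simp add: skolem_lang_def)
  have "is_lang (skolem_lang L sk)"
    using funs' rels' small lesspoll_trans1 unfolding is_lang_def by blast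
  moreover have "lang_card (skolem_lang L sk) \<le> lang_card L"
    unfolding lang_card_def X_def[symmetric]
    using funs' rels' nat X small by (intro cardinality_mono Plus_lepoll)
  ultimately show ?thesis
    using names by blast
qed

section \<open>Transfer from Skolemized structures\<close>

text \<open>
  Every finite tuple of \<open>N\<close> has the quantifier-free type of a tuple in some member of \<open>S\<close>;
  valuations with finite range play the role of finite tuples.
\<close>

definition finitely_realized :: "'u lang \<Rightarrow> 'u struc \<Rightarrow> 'u struc set \<Rightarrow> bool" where
  "finitely_realized L N S \<longleftrightarrow> (\<forall>v. range v \<subseteq> carrier N \<longrightarrow> finite (range v) \<longrightarrow>
     (\<exists>B\<in>S. \<exists>w. range w \<subseteq> carrier B \<and> same_atomic L N v B w))"

lemma same_atomic_update:
  assumes "same_atomic L N v B w" "wf_trm L t"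
  shows "same_atomic L N (v(k := eval_trm N v t)) B (w(k := eval_trm B w t))"
proof -
  have upd: "(\<lambda>j. eval_trm P u ((Var(k := t)) j)) = u(k := eval_trm P u t)" for P u
    by auto
  have "wf_trm L ((Var(k := t)) j)" for j
    using assms(2) by simp
  then show ?thesis
    using same_atomic_subst[OF assms(1), of "Var(k := t)"] unfolding upd by simp
qed

text \<open>
  The criterion of Tarski and Vaught, with the members of a family of structures in place of one
  superstructure: if every finite tuple of \<open>N\<close> has the quantifier-free type, in the language
  with Skolem functions, of a tuple in some Skolemized structure, then these two tuples satisfy
  the same formulas of the original language.
\<close>

lemma skolem_transfer:
  assumes N: "is_struc (skolem_lang L sk) N"
    and S: "\<And>B. B \<in> S \<Longrightarrow> is_struc (skolem_lang L sk) B \<and> has_skolem_functions L sk B"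
    and real: "finitely_realized (skolem_lang L sk) N S"
  shows "wf_fm L \<phi> \<Longrightarrow> range v \<subseteq> carrier N \<Longrightarrow> finite (range v) \<Longrightarrow> B \<in> S \<Longrightarrow>
    range w \<subseteq> carrier B \<Longrightarrow> same_atomic (skolem_lang L sk) N v B w \<Longrightarrow> sat N v \<phi> = sat B w \<phi>"
proof (induction \<phi> arbitrary: v B w)
  case (Eq s t)
  then show ?case
    using same_atomicD wf_fm_mono[OF sublang_skolem_lang] by (metis atomic.simps(1))
next
  case (Rel r ts)
  then show ?case
    using same_atomicD wf_fm_mono[OF sublang_skolem_lang] by (metis atomic.simps(2))
next
  case (Neg \<phi>)
  then show ?case
    by (metis sat.simps(3) wf_fm.simps(3))
next
  case (And \<phi> \<psi>)
  then show ?case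
    by (metis sat.simps(4) wf_fm.simps(4))
next
  case (Ex k \<phi>)
  let ?\<sigma> = "skolem_lang L sk"
  define s where "s = App (sk (k, \<phi>)) (map Var (skolem_args k \<phi>))"
  have \<phi>: "wf_fm L \<phi>"
    using Ex.prems by simp
  then have s: "wf_trm ?\<sigma> s"
    by (auto simp: s_def skolem_lang_def)
  have eval_s: "eval_trm P u s = fn P (sk (k, \<phi>)) (map u (skolem_args k \<phi>))" for P u
    by (simp add: s_def comp_def)
  have skolem: "sat C (u(k := eval_trm C u s)) \<phi>"
    if "C \<in> S" "range u \<subseteq> carrier C" "sat C u (Ex k \<phi>)" for C u
    using S[OF that(1)] that(2,3) \<phi> unfolding has_skolem_functions_def eval_s by blast
  \<comment> \<open>The value of the Skolem term for \<open>\<exists>k. \<phi>\<close> is a witness in \<open>N\<close> iff it is one in \<open>B\<close>.\<close>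
  have IH: "sat N (u(k := eval_trm N u s)) \<phi> = sat C (u'(k := eval_trm C u' s)) \<phi>"
    if "range u \<subseteq> carrier N" "finite (range u)" "C \<in> S" "range u' \<subseteq> carrier C"
      "same_atomic ?\<sigma> N u C u'" for u C u'
  proof (rule Ex.IH)
    show "range (u(k := eval_trm N u s)) \<subseteq> carrier N"
      using that(1) eval_trm_in_carrier[OF N that(1) s] by auto
    have "range (u(k := eval_trm N u s)) \<subseteq> insert (eval_trm N u s) (range u)"
      by auto
    then show "finite (range (u(k := eval_trm N u s)))"
      using that(2) finite_subset by blast
    show "range (u'(k := eval_trm C u' s)) \<subseteq> carrier C"
      using that(3,4) S eval_trm_in_carrier[OF _ that(4) s] by auto
    show "same_atomic ?\<sigma> N (u(k := eval_trm N u s)) C (u'(k := eval_trm C u' s))"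
      by (rule same_atomic_update[OF that(5) s])
  qed (use \<phi> that in auto)
  show ?case
  proof
    assume "sat N v (Ex k \<phi>)"
    then obtain x where x: "x \<in> carrier N" "sat N (v(k := x)) \<phi>"
      by auto
    have ran: "range (v(k := x)) \<subseteq> carrier N" "range (v(k := x)) \<subseteq> insert x (range v)"
      using x(1) Ex.prems(2) by auto
    then have fin: "finite (range (v(k := x)))"
      using Ex.prems(3) finite_subset by blast
    \<comment> \<open>\<open>B\<close> need not contain a counterpart of \<open>x\<close>, but some member of \<open>S\<close> does, and
      the Skolem term is a witness there.  It does not mention the variable \<open>k\<close>, so its value
      in \<open>N\<close> is not affected by \<open>x\<close>, and it is a witness in \<open>B\<close> as well.\<close>
    obtain C u where C: "C \<in> S" "range u \<subseteq> carrier C" "same_atomic ?\<sigma> N (v(k := x)) C u"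
      using real ran(1) fin unfolding finitely_realized_def by blast
    have "sat C u \<phi>"
      using Ex.IH[OF \<phi> ran(1) fin C] x(2) by (simp only: )
    then have "sat C u (Ex k \<phi>)"
      using C(2) by (auto intro!: bexI[of _ "u k"])
    then have "sat N ((v(k := x))(k := eval_trm N (v(k := x)) s)) \<phi>"
      using IH[OF ran(1) fin C] skolem[OF C(1,2)] by simp
    moreover have "eval_trm N (v(k := x)) s = eval_trm N v s"
      by (rule eval_trm_cong) (auto simp: s_def)
    ultimately have "sat B (w(k := eval_trm B w s)) \<phi>"
      using IH[OF Ex.prems(2-6)] by simp
    then show "sat B w (Ex k \<phi>)"
      using eval_trm_in_carrier[OF _ Ex.prems(5) s] S[OF Ex.prems(4)] by auto
  next
    assume "sat B w (Ex k \<phi>)"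
    then have "sat N (v(k := eval_trm N v s)) \<phi>"
      using IH[OF Ex.prems(2-6)] skolem[OF Ex.prems(4,5)] by simp
    then show "sat N v (Ex k \<phi>)"
      using eval_trm_in_carrier[OF N Ex.prems(2) s] by auto
  qed
qed

corollary skolem_transfer_theory:
  assumes N: "is_struc (skolem_lang L sk) N"
    and S: "\<And>B. B \<in> S \<Longrightarrow> is_struc (skolem_lang L sk) B \<and> has_skolem_functions L sk B"
    and real: "finitely_realized (skolem_lang L sk) N S"
    and T: "is_theory L T" "\<And>B. B \<in> S \<Longrightarrow> models (reduct L B) T"
  shows "models (reduct L N) T"
  unfolding models_def
proof (intro ballI allI impI)
  fix \<phi> and v :: "nat \<Rightarrow> 'a"
  assume "\<phi> \<in> T" and v: "range v \<subseteq> carrier (reduct L N)"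
  then have \<phi>: "wf_fm L \<phi>" "fv_fm \<phi> = {}"
    using T(1) unfolding is_theory_def by auto
  have "range (\<lambda>_ :: nat. v 0) \<subseteq> carrier N" and fin: "finite (range (\<lambda>_ :: nat. v 0))"
    using v by auto
  then obtain B w where B: "B \<in> S" "range w \<subseteq> carrier B"
      "same_atomic (skolem_lang L sk) N (\<lambda>_. v 0) B w"
    using real unfolding finitely_realized_def by blast
  have "sat B w \<phi>"
    using T(2)[OF B(1)] B(2) \<open>\<phi> \<in> T\<close> sat_reduct[OF \<phi>(1)] unfolding models_def by auto
  then have "sat N (\<lambda>_. v 0) \<phi>"
    using skolem_transfer[OF N S real \<phi>(1) _ fin B] v by auto
  then show "sat (reduct L N) v \<phi>"
    using sat_cong[of \<phi> v "\<lambda>_. v 0" N] \<phi> by (simp add: sat_reduct)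
qed

text \<open>
  A realization in \<open>N\<close> of a type in finitely many variables can be taken to have finite range,
  and then it is matched by a realization in a member of \<open>S\<close>.
\<close>

corollary skolem_transfer_omits:
  assumes N: "is_struc (skolem_lang L sk) N"
    and S: "\<And>B. B \<in> S \<Longrightarrow> is_struc (skolem_lang L sk) B \<and> has_skolem_functions L sk B"
    and real: "finitely_realized (skolem_lang L sk) N S"
    and q: "is_syntactic_type L q" "\<And>B. B \<in> S \<Longrightarrow> omits (reduct L B) q"
  shows "omits (reduct L N) q"
  unfolding omits_def
proof
  assume "\<exists>v. range v \<subseteq> carrier (reduct L N) \<and> (\<forall>\<phi>\<in>q. sat (reduct L N) v \<phi>)"
  then obtain v where v: "range v \<subseteq> carrier N" "\<And>\<phi>. \<phi> \<in> q \<Longrightarrow> sat (reduct L N) v \<phi>"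
    by auto
  obtain n where n: "\<And>\<phi>. \<phi> \<in> q \<Longrightarrow> wf_fm L \<phi> \<and> fv_fm \<phi> \<subseteq> {..<n}"
    using q(1) unfolding is_syntactic_type_def by blast
  define u where "u k = (if k < n then v k else v 0)" for k
  have "range u \<subseteq> v ` insert 0 {..<n}"
    by (auto simp: u_def)
  then have ran: "range u \<subseteq> carrier N" and fin: "finite (range u)"
    using v(1) finite_subset by blast+
  then obtain B w where B: "B \<in> S" "range w \<subseteq> carrier B" "same_atomic (skolem_lang L sk) N u B w"
    using real unfolding finitely_realized_def by blast
  have "sat (reduct L B) w \<phi>" if "\<phi> \<in> q" for \<phi>
  proof -
    have "sat N v \<phi> = sat N u \<phi>"
      using n[OF that] by (intro sat_cong) (auto simp: u_def)
    then show ?thesis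
      using skolem_transfer[OF N S real _ ran fin B] n[OF that] v(2)[OF that] by (simp add: sat_reduct)
  qed
  then have "\<exists>w. range w \<subseteq> carrier (reduct L B) \<and> (\<forall>\<phi>\<in>q. sat (reduct L B) w \<phi>)"
    using B(2) by (intro exI[of _ w]) simp
  with q(2)[OF B(1)] show False
    unfolding omits_def by (rule notE)
qed

section \<open>The term-generated part of a reduced product\<close>

text \<open>
  This serves to represent the classes of a quotient by elements of the universe, in such a way
  that the class of \<open>p x\<close> is represented by \<open>x\<close> itself.  A structure that is built on the
  quotient then contains \<open>A\<close> as a subset.
\<close>

lemma quotient_representation:
  fixes U :: "'f set" and eqv :: "'f \<Rightarrow> 'f \<Rightarrow> bool" and A :: "'u set"
  assumes unc: "uncountable (UNIV :: 'u set)" and small: "A \<prec> (UNIV :: 'u set)" "U \<prec> (UNIV :: 'u set)"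
    and refl: "\<And>f. eqv f f" and sym: "\<And>f g. eqv f g \<Longrightarrow> eqv g f"
    and trans: "\<And>f g h. eqv f g \<Longrightarrow> eqv g h \<Longrightarrow> eqv f h"
    and dist: "\<And>x y. x \<in> A \<Longrightarrow> y \<in> A \<Longrightarrow> eqv (p x) (p y) \<Longrightarrow> x = y"
  shows "\<exists>e :: 'f \<Rightarrow> 'u. (\<forall>f\<in>U. \<forall>g\<in>U. e f = e g \<longleftrightarrow> eqv f g) \<and> (\<forall>x\<in>A. e (p x) = x)"
proof -
  define cls where "cls f = {g. eqv f g}" for f
  have cls_eq: "cls f = cls g \<longleftrightarrow> eqv f g" for f g
    unfolding cls_def using refl sym trans by blast
  have "cls ` U \<lesssim> (UNIV :: 'u set) - A"
    using lepoll_complement[OF _ small(1)] unc countable_finite small(2) image_lepoll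
      lesspoll_imp_lepoll lepoll_trans by meson
  then obtain j where j: "inj_on j (cls ` U)" "j ` cls ` U \<subseteq> UNIV - A"
    unfolding lepoll_def by blast
  define e where "e f = (if \<exists>x\<in>A. eqv (p x) f then THE x. x \<in> A \<and> eqv (p x) f else j (cls f))" for f
  have e_p: "e f = x" if "x \<in> A" "eqv (p x) f" for x f
  proof -
    have "(THE x. x \<in> A \<and> eqv (p x) f) = x"
      using that dist sym trans by (intro the_equality) blast+
    then show ?thesis
      using that unfolding e_def by auto
  qed
  have "e f = e g \<longleftrightarrow> eqv f g" if "f \<in> U" "g \<in> U" for f g
  proof (cases "(\<exists>x\<in>A. eqv (p x) f) \<or> (\<exists>x\<in>A. eqv (p x) g)")
    case True
    then show ?thesis
    proof
      assume "\<exists>x\<in>A. eqv (p x) f"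
      then obtain x where x: "x \<in> A" "eqv (p x) f"
        by blast
      show ?thesis
      proof (cases "\<exists>y\<in>A. eqv (p y) g")
        case True
        then obtain y where y: "y \<in> A" "eqv (p y) g"
          by blast
        then show ?thesis
          using x e_p[OF x] e_p[OF y] dist sym trans by metis
      next
        case False
        then have "e g \<notin> A"
          using j(2) that unfolding e_def by auto
        then show ?thesis
          using x e_p[OF x] False trans by metis
      qed
    next
      assume "\<exists>x\<in>A. eqv (p x) g"
      then obtain x where x: "x \<in> A" "eqv (p x) g"
        by blast
      show ?thesis
      proof (cases "\<exists>y\<in>A. eqv (p y) f")
        case True
        then obtain y where y: "y \<in> A" "eqv (p y) f"
          by blast
        then show ?thesis
          using x e_p[OF x] e_p[OF y] dist sym trans by metis
      next
        case False
        then have "e f \<notin> A"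
          using j(2) that unfolding e_def by auto
        then show ?thesis
          using x e_p[OF x] False trans sym by metis
      qed
    qed
  next
    case False
    then have "e f = j (cls f)" "e g = j (cls g)"
      unfolding e_def by simp_all
    then show ?thesis
      using j(1) that cls_eq by (metis image_eqI inj_on_eq_iff)
  qed
  then show ?thesis
    using e_p refl by blast
qed

text \<open>
  The theorem of Los holds for atomic formulas and an arbitrary filter, because equality and
  the relations of a reduced product are defined by it.  The functions that are values of terms
  at the projections \<open>p x\<close> are closed under the operations, and there are few of them.
\<close>

lemma term_reduced_product:
  fixes L :: "'u lang" and A :: "'u set" and G :: "'i filter"
    and B :: "'i \<Rightarrow> 'u struc" and p :: "'u \<Rightarrow> 'i \<Rightarrow> 'u"
  assumes unc: "uncountable (UNIV :: 'u set)" and L: "is_lang L"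
    and A: "A \<noteq> {}" "A \<prec> (UNIV :: 'u set)"
    and dist: "\<And>x y. x \<in> A \<Longrightarrow> y \<in> A \<Longrightarrow> \<forall>\<^sub>F i in G. p x i = p y i \<Longrightarrow> x = y"
  shows "\<exists>N. is_struc L N \<and> A \<subseteq> carrier N \<and>
    (\<forall>x\<in>carrier N. \<exists>t v. wf_trm L t \<and> range v \<subseteq> A \<and> x = eval_trm N v t) \<and>
    (\<forall>v \<phi>. range v \<subseteq> A \<longrightarrow> atomic \<phi> \<longrightarrow> wf_fm L \<phi> \<longrightarrow>
      (sat N v \<phi> \<longleftrightarrow> (\<forall>\<^sub>F i in G. sat (B i) (\<lambda>k. p (v k) i) \<phi>)))"
proof -
  obtain a0 where a0: "a0 \<in> A"
    using A(1) by blast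
  define val where "val t v = (\<lambda>i. eval_trm (B i) (\<lambda>k. p (v k) i) t)" for t and v :: "nat \<Rightarrow> 'u"
  define U where "U = {val t v | t v. wf_trm L t \<and> range v \<subseteq> A}"
  have valU: "val t v \<in> U" if "wf_trm L t" "range v \<subseteq> A" for t v
    using that unfolding U_def by blast
  have pU: "p x \<in> U" if "x \<in> A" for x
    using valU[of "Var 0" "\<lambda>_. x"] that by (auto simp: val_def)

  define X where "X = funs L <+> A <+> (UNIV :: nat set)"
  have infX: "infinite X"
    by (simp add: X_def)
  have X: "X \<prec> (UNIV :: 'u set)"
    using L A unc countable_finite nat_lesspoll_uncountable[OF unc]
    unfolding X_def is_lang_def by (intro Plus_lesspoll) auto
  have "funs L \<lesssim> X" and AX: "A \<lesssim> X"
    unfolding X_def lepoll_def by (intro exI[of _ Inl] exI[of _ "Inr \<circ> Inl"]; auto simp: inj_on_def)+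
  then have "fst ` funs L \<lesssim> X"
    using image_lepoll lepoll_trans by blast
  then have "{t. set_trm t \<subseteq> fst ` funs L} \<lesssim> X"
    by (rule terms_lepoll[OF _ infX])
  then have count: "{t. set_trm t \<subseteq> fst ` funs L} \<times> lists A \<lesssim> X"
    using lists_lepoll[OF AX infX] infX by (rule Times_lepoll)
  have "U \<subseteq> (\<lambda>(t, xs). val t (\<lambda>k. if k < length xs then xs ! k else a0)) `
      ({t. set_trm t \<subseteq> fst ` funs L} \<times> lists A)"
  proof
    fix f
    assume "f \<in> U"
    then obtain t v where f: "f = val t v" "wf_trm L t" "range v \<subseteq> A"
      unfolding U_def by blast
    obtain m where m: "\<And>k. k \<in> fv_trm t \<Longrightarrow> k < m"
      using finite_nat_set_iff_bounded finite_fv_trm by metis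
    define xs where "xs = map v [0..<m]"
    have "f = val t (\<lambda>k. if k < length xs then xs ! k else a0)"
      unfolding f(1) val_def by (intro ext eval_trm_cong) (simp add: xs_def m)
    moreover have "t \<in> {t. set_trm t \<subseteq> fst ` funs L}"
      using set_trm_wf[OF f(2)] by simp
    moreover have "xs \<in> lists A"
      using range_subsetD[OF f(3)] by (auto simp: xs_def)
    ultimately show "f \<in> (\<lambda>(t, xs). val t (\<lambda>k. if k < length xs then xs ! k else a0)) `
      ({t. set_trm t \<subseteq> fst ` funs L} \<times> lists A)"
      by (intro image_eqI[of _ _ "(t, xs)"]) auto
  qed
  then have "U \<lesssim> X"
    using count subset_image_lepoll lepoll_trans by blast
  then have U: "U \<prec> (UNIV :: 'u set)"
    using X lesspoll_trans1 by blast

  \<comment> \<open>The variables of the arguments are kept apart by pairing them with the position.\<close>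
  have closed: "(\<lambda>i. fn (B i) g (map (\<lambda>f. f i) fs)) \<in> U"
    if g: "(g, length fs) \<in> funs L" and fs: "set fs \<subseteq> U" for g fs
  proof -
    have "\<forall>f. \<exists>t v. f \<in> U \<longrightarrow> wf_trm L t \<and> range v \<subseteq> A \<and> f = val t v"
      unfolding U_def by blast
    then obtain t v where tv: "\<And>f. f \<in> U \<Longrightarrow> wf_trm L (t f) \<and> range (v f) \<subseteq> A \<and> f = val (t f) (v f)"
      by metis
    define s where "s j = subst_trm (\<lambda>k. Var (prod_encode (j, k))) (t (fs ! j))" for j
    define w where "w m = (case prod_decode m of (j, k) \<Rightarrow> if j < length fs then v (fs ! j) k else a0)" for m
    have fsU: "fs ! j \<in> U" if "j < length fs" for j
      using that fs nth_mem by blast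
    have "w m \<in> A" for m
      using tv[OF fsU] a0 unfolding w_def by (auto split: prod.split)
    then have "range w \<subseteq> A"
      by blast
    moreover have "wf_trm L (App g (map s [0..<length fs]))"
      using g tv[OF fsU] unfolding s_def by (auto intro: wf_subst_trm)
    moreover have "eval_trm (B i) (\<lambda>k. p (w k) i) (s j) = (fs ! j) i" if "j < length fs" for i j
    proof -
      have "eval_trm (B i) (\<lambda>k. p (w k) i) (s j) = eval_trm (B i) (\<lambda>k. p (v (fs ! j) k) i) (t (fs ! j))"
        using that by (simp add: s_def w_def eval_subst_trm)
      also have "\<dots> = (fs ! j) i"
        using tv[OF fsU[OF that]] unfolding val_def by metis
      finally show ?thesis .
    qed
    then have "map (eval_trm (B i) (\<lambda>k. p (w k) i)) (map s [0..<length fs]) = map (\<lambda>f. f i) fs" for i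
      by (intro nth_equalityI) auto
    then have "(\<lambda>i. fn (B i) g (map (\<lambda>f. f i) fs)) = val (App g (map s [0..<length fs])) w"
      unfolding val_def eval_trm.simps by (intro ext) (simp only:)
    ultimately show ?thesis
      using valU by simp
  qed

  define eqv where "eqv f g \<longleftrightarrow> (\<forall>\<^sub>F i in G. f i = g i)" for f g :: "'i \<Rightarrow> 'u"
  have eqv_refl: "eqv f f" and eqv_sym: "eqv f g \<Longrightarrow> eqv g f" for f g
    by (auto simp: eqv_def eq_commute)
  have eqv_trans: "eqv f g \<Longrightarrow> eqv g h \<Longrightarrow> eqv f h" for f g h
    unfolding eqv_def by (auto elim: eventually_elim2)
  have "\<exists>e. (\<forall>f\<in>U. \<forall>g\<in>U. e f = e g \<longleftrightarrow> eqv f g) \<and> (\<forall>x\<in>A. e (p x) = x)"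
  proof (rule quotient_representation[OF unc A(2) U eqv_refl eqv_sym eqv_trans])
    show "x = y" if "x \<in> A" "y \<in> A" "eqv (p x) (p y)" for x y
      using that dist unfolding eqv_def by blast
  qed
  then obtain e where e: "\<And>f g. f \<in> U \<Longrightarrow> g \<in> U \<Longrightarrow> e f = e g \<longleftrightarrow> eqv f g"
    and e_p: "\<And>x. x \<in> A \<Longrightarrow> e (p x) = x"
    by blast
  define rep where "rep = inv_into U e"
  have rep: "rep x \<in> U" if "x \<in> e ` U" for x
    using that unfolding rep_def by (rule inv_into_into)
  have e_rep: "e (rep x) = x" if "x \<in> e ` U" for x
    using that unfolding rep_def by (rule f_inv_into_f)
  have rep_e: "\<forall>\<^sub>F i in G. rep (e f) i = f i" if "f \<in> U" for f
    using e[OF rep that] e_rep that unfolding eqv_def by blast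
  define N where "N = \<lparr>carrier = e ` U,
    fn = (\<lambda>g xs. if (g, length xs) \<in> funs L \<and> set xs \<subseteq> e ` U
      then e (\<lambda>i. fn (B i) g (map (\<lambda>x. rep x i) xs)) else undefined),
    rl = (\<lambda>r xs. (r, length xs) \<in> rels L \<and> set xs \<subseteq> e ` U \<and>
      (\<forall>\<^sub>F i in G. rl (B i) r (map (\<lambda>x. rep x i) xs)))\<rparr>"
  have carrier_N: "carrier N = e ` U"
    by (simp add: N_def)
  have fn_N: "fn N g xs = e (\<lambda>i. fn (B i) g (map (\<lambda>x. rep x i) xs))"
    if "(g, length xs) \<in> funs L" "set xs \<subseteq> e ` U" for g xs
    using that by (simp add: N_def)
  have rl_N: "rl N r xs \<longleftrightarrow> (\<forall>\<^sub>F i in G. rl (B i) r (map (\<lambda>x. rep x i) xs))"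
    if "(r, length xs) \<in> rels L" "set xs \<subseteq> e ` U" for r xs
    using that by (simp add: N_def)
  have closed': "(\<lambda>i. fn (B i) g (map (\<lambda>x. rep x i) xs)) \<in> U"
    if "(g, length xs) \<in> funs L" "set xs \<subseteq> e ` U" for g xs
    using closed[of g "map rep xs"] that rep by (auto simp: comp_def)
  have N: "is_struc L N"
    unfolding is_struc_def
  proof (intro conjI allI impI)
    show "carrier N \<noteq> {}"
      using pU[OF a0] carrier_N by blast
    show "carrier N \<prec> (UNIV :: 'u set)"
      unfolding carrier_N using U image_lepoll lesspoll_trans1 by blast
    show "if (g, length xs) \<in> funs L \<and> set xs \<subseteq> carrier N then fn N g xs \<in> carrier N
        else fn N g xs = undefined" for g xs
      using closed'[of g xs] by (simp add: N_def)
    show "(r, length xs) \<in> rels L" "set xs \<subseteq> carrier N" if "rl N r xs" for r xs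
      using that by (simp_all add: N_def)
  qed
  have AN: "A \<subseteq> carrier N"
    using pU e_p carrier_N by (metis image_eqI subsetI)
  have eval: "eval_trm N v t = e (val t v)" if "wf_trm L t" and v: "range v \<subseteq> A" for t v
    using that(1)
  proof (induction t)
    case (Var k)
    then show ?case
      using e_p[OF range_subsetD[OF v]] by (simp add: val_def)
  next
    case (App g ts)
    let ?xs = "map (\<lambda>t. e (val t v)) ts"
    have "map (eval_trm N v) ts = ?xs"
      using App by simp
    moreover have g: "(g, length ?xs) \<in> funs L" and xs: "set ?xs \<subseteq> e ` U"
      using App.prems valU[OF _ v] by auto
    ultimately have "eval_trm N v (App g ts) = e (\<lambda>i. fn (B i) g (map (\<lambda>x. rep x i) ?xs))"
      by (simp only: eval_trm.simps fn_N)
    also have "\<dots> = e (val (App g ts) v)"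
    proof -
      have "\<forall>\<^sub>F i in G. \<forall>t\<in>set ts. rep (e (val t v)) i = val t v i"
        using App.prems by (intro eventually_ball_finite) (auto intro!: rep_e valU v)
      then have "eqv (\<lambda>i. fn (B i) g (map (\<lambda>x. rep x i) ?xs)) (val (App g ts) v)"
        unfolding eqv_def
      proof (rule eventually_mono)
        fix i
        assume "\<forall>t\<in>set ts. rep (e (val t v)) i = val t v i"
        then have "map (\<lambda>x. rep x i) ?xs = map (eval_trm (B i) (\<lambda>k. p (v k) i)) ts"
          by (simp add: val_def)
        then show "fn (B i) g (map (\<lambda>x. rep x i) ?xs) = val (App g ts) v i"
          by (simp only: val_def eval_trm.simps)
      qed
      then show ?thesis
        using e[OF closed'[OF g xs] valU[OF App.prems v]] by simp
    qed
    finally show ?case .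
  qed
  have gen: "\<exists>t v. wf_trm L t \<and> range v \<subseteq> A \<and> x = eval_trm N v t" if x: "x \<in> carrier N" for x
  proof -
    obtain t v where "wf_trm L t" "range v \<subseteq> A" "x = e (val t v)"
      using x unfolding carrier_N U_def by auto
    then show ?thesis
      using eval by metis
  qed
  have "sat N v \<phi> \<longleftrightarrow> (\<forall>\<^sub>F i in G. sat (B i) (\<lambda>k. p (v k) i) \<phi>)"
    if v: "range v \<subseteq> A" and \<phi>: "atomic \<phi>" "wf_fm L \<phi>" for v \<phi>
  proof (cases \<phi>)
    case (Eq s t)
    then have "sat N v \<phi> \<longleftrightarrow> eqv (val s v) (val t v)"
      using \<phi> e[OF valU valU] eval v by simp
    then show ?thesis
      by (simp add: Eq eqv_def val_def)
  next
    case (Rel r ts)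
    let ?xs = "map (\<lambda>t. e (val t v)) ts"
    have wf: "(r, length ts) \<in> rels L" "\<And>t. t \<in> set ts \<Longrightarrow> wf_trm L t"
      using \<phi>(2) Rel by auto
    have "map (eval_trm N v) ts = ?xs"
      using wf(2) eval v by simp
    moreover have "(r, length ?xs) \<in> rels L" "set ?xs \<subseteq> e ` U"
      using valU[OF _ v] wf by auto
    ultimately have "sat N v \<phi> \<longleftrightarrow> (\<forall>\<^sub>F i in G. rl (B i) r (map (\<lambda>x. rep x i) ?xs))"
      by (simp only: Rel sat.simps rl_N)
    also have "\<dots> \<longleftrightarrow> (\<forall>\<^sub>F i in G. sat (B i) (\<lambda>k. p (v k) i) \<phi>)"
    proof (rule eventually_subst)
      have "\<forall>\<^sub>F i in G. \<forall>t\<in>set ts. rep (e (val t v)) i = val t v i"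
        using wf(2) by (intro eventually_ball_finite) (auto intro!: rep_e valU v)
      then show "\<forall>\<^sub>F i in G. rl (B i) r (map (\<lambda>x. rep x i) ?xs) = sat (B i) (\<lambda>k. p (v k) i) \<phi>"
      proof (rule eventually_mono)
        fix i
        assume "\<forall>t\<in>set ts. rep (e (val t v)) i = val t v i"
        then have "map (\<lambda>x. rep x i) ?xs = map (eval_trm (B i) (\<lambda>k. p (v k) i)) ts"
          by (simp add: val_def)
        then show "rl (B i) r (map (\<lambda>x. rep x i) ?xs) = sat (B i) (\<lambda>k. p (v k) i) \<phi>"
          by (simp only: Rel sat.simps)
      qed
    qed
    finally show ?thesis .
  qed (use \<phi> in auto)
  then show ?thesis
    using N AN gen by (intro exI[of _ N]) simp
qed

section \<open>Increasing tuples\<close>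

lemma ordered_classD:
  assumes "ordered_class K lt" "I \<in> members K"
  shows "x \<in> carrier I \<Longrightarrow> \<not> rl I lt [x, x]"
    and "x \<in> carrier I \<Longrightarrow> y \<in> carrier I \<Longrightarrow> z \<in> carrier I \<Longrightarrow>
      rl I lt [x, y] \<Longrightarrow> rl I lt [y, z] \<Longrightarrow> rl I lt [x, z]"
    and "x \<in> carrier I \<Longrightarrow> y \<in> carrier I \<Longrightarrow> x \<noteq> y \<Longrightarrow> rl I lt [x, y] \<or> rl I lt [y, x]"
proof -
  have order: "irreflp_on (carrier I) (\<lambda>x y. rl I lt [x, y])" "transp_on (carrier I) (\<lambda>x y. rl I lt [x, y])"
    "totalp_on (carrier I) (\<lambda>x y. rl I lt [x, y])"
    using assms by (simp_all add: ordered_class_def)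
  show "x \<in> carrier I \<Longrightarrow> \<not> rl I lt [x, x]"
    using irreflp_onD[OF order(1)] by blast
  show "x \<in> carrier I \<Longrightarrow> y \<in> carrier I \<Longrightarrow> z \<in> carrier I \<Longrightarrow>
      rl I lt [x, y] \<Longrightarrow> rl I lt [y, z] \<Longrightarrow> rl I lt [x, z]"
    by (rule transp_onD[OF order(2)])
  show "x \<in> carrier I \<Longrightarrow> y \<in> carrier I \<Longrightarrow> x \<noteq> y \<Longrightarrow> rl I lt [x, y] \<or> rl I lt [y, x]"
    by (rule totalp_onD[OF order(3)])
qed

lemma increasing_Cons:
  "increasing lt I (x # a) \<longleftrightarrow> x \<in> carrier I \<and> (\<forall>y\<in>set a. rl I lt [x, y]) \<and> increasing lt I a"
  by (auto simp: increasing_def)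

lemma increasing_distinct:
  assumes "ordered_class K lt" "I \<in> members K"
  shows "increasing lt I a \<Longrightarrow> distinct a"
proof (induction a)
  case (Cons x a)
  then have "x \<notin> set a"
    using ordered_classD(1)[OF assms, of x] by (auto simp: increasing_Cons)
  then show ?case
    using Cons by (simp add: increasing_Cons)
qed simp

lemma increasing_unique:
  assumes K: "ordered_class K lt" "I \<in> members K"
  shows "increasing lt I a \<Longrightarrow> increasing lt I b \<Longrightarrow> set a = set b \<Longrightarrow> a = b"
proof (induction a arbitrary: b)
  case Nil
  then show ?case by simp
next
  case (Cons x a)
  then obtain y c where b: "b = y # c"
    by (cases b) auto
  have inc: "increasing lt I (x # a)" "increasing lt I (y # c)"
    using Cons.prems b by auto
  then have xy: "x \<in> carrier I" "y \<in> carrier I"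
    by (simp_all add: increasing_Cons)
  have "x = y"
  proof (rule ccontr)
    assume "x \<noteq> y"
    then have "x \<in> set c" "y \<in> set a"
      using Cons.prems(3) b by auto
    then have "rl I lt [y, x]" "rl I lt [x, y]"
      using inc by (simp_all add: increasing_Cons)
    then show False
      using ordered_classD(1,2)[OF K] xy by blast
  qed
  moreover have "x \<notin> set a" "y \<notin> set c"
    using increasing_distinct[OF K inc(1)] increasing_distinct[OF K inc(2)] by auto
  then have "set a = set c"
    using Cons.prems(3) b \<open>x = y\<close> by auto
  then have "a = c"
    using Cons.IH inc by (simp add: increasing_Cons)
  ultimately show ?case
    using b by simp
qed

lemma increasing_enumeration:
  assumes K: "ordered_class K lt" "I \<in> members K" and S: "finite S" "S \<subseteq> carrier I"
  shows "\<exists>a. increasing lt I a \<and> set a = S"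
  using S
proof (induction S rule: finite_induct)
  case empty
  then show ?case
    by (auto simp: increasing_def)
next
  case (insert x S)
  then obtain a where a: "increasing lt I a" "set a = S"
    by auto
  let ?lt = "\<lambda>y z. rl I lt [y, z]"
  let ?b = "filter (\<lambda>y. ?lt y x) a @ [x] @ filter (\<lambda>y. ?lt x y) a"
  have "set ?b = insert x S"
    using a(2) insert ordered_classD(3)[OF K] by auto
  moreover have "?lt y z" if "y \<in> S" "?lt y x" "z \<in> S" "?lt x z" for y z
    using that insert.prems ordered_classD(2)[OF K] by blast
  then have "sorted_wrt ?lt ?b"
    using a unfolding increasing_def by (auto simp: sorted_wrt_append sorted_wrt_filter)
  ultimately show ?case
    using insert.prems unfolding increasing_def by (intro exI[of _ ?b]) simp
qed

lemma increasing_sublist: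
  assumes K: "ordered_class K lt" "I \<in> members K"
    and "increasing lt I a" "increasing lt I c" "set c \<subseteq> set a"
  shows "\<exists>s\<subseteq>{..<length a}. nths a s = c"
proof -
  have "increasing lt I (filter (\<lambda>x. x \<in> set c) a)"
    using assms(3) unfolding increasing_def by (auto intro: sorted_wrt_filter)
  then have "filter (\<lambda>x. x \<in> set c) a = c"
    using assms(4,5) by (intro increasing_unique[OF K]) auto
  then show ?thesis
    unfolding filter_eq_nths by (intro exI[of _ "{i. i < length a \<and> a ! i \<in> set c}"]) auto
qed

lemma tp_in_S_inc:
  "I \<in> members K \<Longrightarrow> increasing lt I a \<Longrightarrow> tp K I a \<in> S_inc_n K lt (length a)"
  by (auto simp: S_inc_n_def)

lemma tp_in_S_inc_all:
  "I \<in> members K \<Longrightarrow> increasing lt I a \<Longrightarrow> tp K I a \<in> S_inc K lt"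
  using tp_in_S_inc by (force simp: S_inc_def)

lemma blueprint_length:
  assumes "blueprint K lt \<sigma> \<Phi>" "I \<in> members K" "increasing lt I a"
    and "\<Phi> (tp K I a) = tp (all_strucs \<sigma>) B b" "is_struc \<sigma> B" "set b \<subseteq> carrier B"
  shows "length b = length a"
proof -
  have \<sigma>: "is_lang \<sigma>" and "\<Phi> (tp K I a) \<in> S_n (all_strucs \<sigma>) (length a)"
    using assms(1) tp_in_S_inc[OF assms(2,3)] unfolding blueprint_def by blast+
  then obtain M c where "tp (all_strucs \<sigma>) B b = tp (all_strucs \<sigma>) M c" "is_struc \<sigma> M"
      "set c \<subseteq> carrier M" "length c = length a"
    using assms(4) unfolding S_n_def by auto
  then show ?thesis
    using tp_eq_length[OF abstract_class_all_strucs[OF \<sigma>], of B b M c] assms(5,6) by simp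
qed

text \<open>
  If a tuple \<open>b\<close> realizes the type that the blueprint assigns to \<open>a\<close>, then the subtuples of \<open>b\<close>
  realize those that it assigns to the subtuples of \<open>a\<close>.  So the realizations of \<open>\<Phi>\<close> at
  different increasing tuples are coherent.
\<close>

lemma blueprint_sublist:
  assumes K: "abstract_class K" and \<Phi>: "blueprint K lt \<sigma> \<Phi>"
    and I: "I \<in> members K" "increasing lt I a" and s: "s \<subseteq> {..<length a}"
    and B: "\<Phi> (tp K I a) = tp (all_strucs \<sigma>) B b" "is_struc \<sigma> B" "set b \<subseteq> carrier B"
  shows "\<Phi> (tp K I (nths a s)) = tp (all_strucs \<sigma>) B (nths b s)"
proof -
  have \<sigma>: "is_lang \<sigma>" and "\<Phi> (type_at K (tp K I a) s) = type_at (all_strucs \<sigma>) (\<Phi> (tp K I a)) s"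
    using \<Phi> tp_in_S_inc[OF I] s unfolding blueprint_def by blast+
  moreover have "set a \<subseteq> carrier I"
    using I(2) by (simp add: increasing_def)
  ultimately show ?thesis
    using type_at_tp[OF K I(1)] type_at_tp[OF abstract_class_all_strucs[OF \<sigma>]] B by simp
qed

section \<open>Ehrenfeucht-Mostowski models\<close>

text \<open>
  For every increasing tuple \<open>a\<close> of \<open>I\<close> there are a structure \<open>B a\<close> and a tuple \<open>b a\<close> in it that
  realizes \<open>\<Phi>(tp(a))\<close>.  The increasing tuples are directed by inclusion, and an element \<open>x\<close> of
  \<open>I\<close> is represented by the function that maps \<open>a\<close> to the entry of \<open>b a\<close> at the position of \<open>x\<close>
  in \<open>a\<close>.  In the reduced product of the \<open>B a\<close> by the filter of final segments, the quantifier-free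
  type of an increasing tuple \<open>c\<close> is the one that it has in \<open>B a\<close> for all large \<open>a\<close>, and by
  coherence this is constantly \<open>\<Phi>(tp(c))\<close>.  The part generated by \<open>I\<close> is \<open>EM(I, \<Phi>)\<close>.  Distinct
  elements of \<open>I\<close> stay distinct because the tuples \<open>b a\<close> are without repetitions.
\<close>

lemma EM_exists:
  fixes K :: "'u abs_class"
  assumes unc: "uncountable (UNIV :: 'u set)"
    and K: "abstract_class K" "ordered_class K lt" and \<Phi>: "blueprint K lt \<sigma> \<Phi>"
    and real: "\<And>p. p \<in> S_inc K lt \<Longrightarrow> \<exists>B b. is_struc \<sigma> B \<and> set b \<subseteq> carrier B \<and> distinct b \<and>
      \<Phi> p = tp (all_strucs \<sigma>) B b"
    and I: "I \<in> members K"
  shows "\<exists>N. is_EM K lt \<sigma> \<Phi> I N"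
proof -
  have \<sigma>: "is_lang \<sigma>"
    using \<Phi> by (simp add: blueprint_def)
  note \<sigma>_class = abstract_class_all_strucs[OF \<sigma>]
  have carrier_I: "carrier I \<noteq> {}" "carrier I \<prec> (UNIV :: 'u set)"
    using abstract_classD(1)[OF K(1) I] by (simp_all add: is_struc_def)
  have "\<forall>a. \<exists>B b. increasing lt I a \<longrightarrow> is_struc \<sigma> B \<and> set b \<subseteq> carrier B \<and> distinct b \<and>
      \<Phi> (tp K I a) = tp (all_strucs \<sigma>) B b"
    using real tp_in_S_inc_all[OF I] by blast
  then obtain B b where B: "\<And>a. increasing lt I a \<Longrightarrow> is_struc \<sigma> (B a)"
      "\<And>a. increasing lt I a \<Longrightarrow> set (b a) \<subseteq> carrier (B a)"
      "\<And>a. increasing lt I a \<Longrightarrow> distinct (b a)"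
      "\<And>a. increasing lt I a \<Longrightarrow> \<Phi> (tp K I a) = tp (all_strucs \<sigma>) (B a) (b a)"
    by metis
  have len: "length (b a) = length a" if "increasing lt I a" for a
    using blueprint_length[OF \<Phi> I that] B that by blast
  define idx where "idx x a = (SOME j. j < length a \<and> a ! j = x)" for x :: 'u and a
  have idx: "idx x a < length a \<and> a ! idx x a = x" if "x \<in> set a" for x a
    using that unfolding idx_def in_set_conv_nth by (rule someI_ex)
  define p where "p x a = b a ! idx x a" for x a
  have map_p: "map (\<lambda>x. p x a) a = b a" if a: "increasing lt I a" for a
  proof (rule nth_equalityI)
    fix j
    assume "j < length (map (\<lambda>x. p x a) a)"
    then have j: "j < length a"
      by simp
    then have "idx (a ! j) a = j"
      using idx[of "a ! j" a] increasing_distinct[OF K(2) I a] by (metis nth_eq_iff_index_eq nth_mem)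
    then show "map (\<lambda>x. p x a) a ! j = b a ! j"
      using j by (simp add: p_def)
  qed (simp add: len[OF a])

  define G where "G = (INF S\<in>{S. finite S \<and> S \<subseteq> carrier I}. principal {a. increasing lt I a \<and> S \<subseteq> set a})"
  have ev: "eventually P G \<longleftrightarrow> (\<exists>S. finite S \<and> S \<subseteq> carrier I \<and> (\<forall>a. increasing lt I a \<longrightarrow> S \<subseteq> set a \<longrightarrow> P a))" for P
  proof -
    have "eventually P G \<longleftrightarrow> (\<exists>S\<in>{S. finite S \<and> S \<subseteq> carrier I}.
        eventually P (principal {a. increasing lt I a \<and> S \<subseteq> set a}))"
      unfolding G_def
    proof (rule eventually_INF_base)
      show "\<exists>x\<in>{S. finite S \<and> S \<subseteq> carrier I}. principal {a. increasing lt I a \<and> x \<subseteq> set a}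
           \<le> inf (principal {a. increasing lt I a \<and> S \<subseteq> set a}) (principal {a. increasing lt I a \<and> T \<subseteq> set a})"
        if "S \<in> {S. finite S \<and> S \<subseteq> carrier I}" "T \<in> {S. finite S \<and> S \<subseteq> carrier I}" for S T
        using that by (intro bexI[of _ "S \<union> T"]) auto
    qed auto
    then show ?thesis
      by (auto simp: eventually_principal)
  qed
  have above: "\<exists>a. increasing lt I a \<and> S \<subseteq> set a" if "finite S" "S \<subseteq> carrier I" for S
    using increasing_enumeration[OF K(2) I that] by blast

  have dist: "x = y" if xy: "x \<in> carrier I" "y \<in> carrier I" and "\<forall>\<^sub>F a in G. p x a = p y a" for x y
  proof -
    obtain S where S: "finite S" "S \<subseteq> carrier I" "\<And>a. increasing lt I a \<Longrightarrow> S \<subseteq> set a \<Longrightarrow> p x a = p y a"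
      using \<open>\<forall>\<^sub>F a in G. p x a = p y a\<close> unfolding ev by blast
    obtain a where a: "increasing lt I a" "insert x (insert y S) \<subseteq> set a"
      using above[of "insert x (insert y S)"] S xy by auto
    then have "b a ! idx x a = b a ! idx y a"
      using S(3) unfolding p_def by auto
    moreover have ix: "idx x a < length a" "a ! idx x a = x" and iy: "idx y a < length a" "a ! idx y a = y"
      using idx[of x a] idx[of y a] a(2) by auto
    ultimately have "idx x a = idx y a"
      using B(3)[OF a(1)] len[OF a(1)] by (metis nth_eq_iff_index_eq)
    then show "x = y"
      using ix(2) iy(2) by metis
  qed
  have "\<exists>N. is_struc \<sigma> N \<and> carrier I \<subseteq> carrier N \<and>
    (\<forall>x\<in>carrier N. \<exists>t v. wf_trm \<sigma> t \<and> range v \<subseteq> carrier I \<and> x = eval_trm N v t) \<and>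
    (\<forall>v \<phi>. range v \<subseteq> carrier I \<longrightarrow> atomic \<phi> \<longrightarrow> wf_fm \<sigma> \<phi> \<longrightarrow>
      (sat N v \<phi> \<longleftrightarrow> (\<forall>\<^sub>F a in G. sat (B a) (\<lambda>k. p (v k) a) \<phi>)))"
    using dist by (rule term_reduced_product[OF unc \<sigma> carrier_I])
  then obtain N where N: "is_struc \<sigma> N" "carrier I \<subseteq> carrier N"
    "\<forall>x\<in>carrier N. \<exists>t v. wf_trm \<sigma> t \<and> range v \<subseteq> carrier I \<and> x = eval_trm N v t"
    and sat_N: "\<And>v \<phi>. range v \<subseteq> carrier I \<Longrightarrow> atomic \<phi> \<Longrightarrow> wf_fm \<sigma> \<phi> \<Longrightarrow>
      sat N v \<phi> \<longleftrightarrow> (\<forall>\<^sub>F a in G. sat (B a) (\<lambda>k. p (v k) a) \<phi>)"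
    by blast

  have tp_nonempty: "tp (all_strucs \<sigma>) N c = \<Phi> (tp K I c)" if c: "increasing lt I c" "c \<noteq> []" for c
  proof -
    define \<rho> where "\<rho> k = (if k < length c then k else 0)" for k
    have \<rho>: "\<rho> k < length c" for k
      using c(2) by (simp add: \<rho>_def)
    have cI: "set c \<subseteq> carrier I"
      using c(1) by (simp add: increasing_def)
    have bc: "set (b c) \<subseteq> carrier (B c)" "length (b c) = length c"
      using B(2) len c(1) by auto
    \<comment> \<open>By coherence of the blueprint, the copies of \<open>c\<close> in all the structures \<open>B a\<close> with
      \<open>c \<subseteq> a\<close> have the same type.\<close>
    have same: "same_atomic \<sigma> (B a) (\<lambda>k. p (c ! \<rho> k) a) (B c) (\<lambda>k. b c ! \<rho> k)"
      if a: "increasing lt I a" "set c \<subseteq> set a" for a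
    proof -
      obtain s where s: "s \<subseteq> {..<length a}" "nths a s = c"
        using increasing_sublist[OF K(2) I a(1) c(1) a(2)] by blast
      have eq: "nths (b a) s = map (\<lambda>x. p x a) c"
        using map_p[OF a(1)] s(2) nths_map[of "\<lambda>x. p x a" a s] by simp
      have sub: "set (map (\<lambda>x. p x a) c) \<subseteq> carrier (B a)"
        using set_nths_subset[of "b a" s] B(2)[OF a(1)] unfolding eq by blast
      have "tp (all_strucs \<sigma>) (B a) (map (\<lambda>x. p x a) c) = tp (all_strucs \<sigma>) (B c) (b c)"
        using blueprint_sublist[OF K(1) \<Phi> I a(1) s(1) B(4,1,2)[OF a(1)]] B(4)[OF c(1)] s(2) eq by simp
      then have "((B a, map (\<lambda>x. p x a) c), (B c, b c)) \<in> (type_step (all_strucs \<sigma>))\<^sup>*"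
        using tp_eq_iff_steps[OF \<sigma>_class, of "B a" "map (\<lambda>x. p x a) c" "B c" "b c"]
          B(1)[OF a(1)] B(1)[OF c(1)] sub bc(1) by simp
      then have "same_atomic \<sigma> (B a) (\<lambda>k. map (\<lambda>x. p x a) c ! \<rho> k) (B c) (\<lambda>k. b c ! \<rho> k)"
        by (rule same_atomic_if_type_steps) (simp add: \<rho>)
      then show ?thesis
        using \<rho> by simp
    qed
    have ranges: "range (\<lambda>k. c ! \<rho> k) \<subseteq> carrier I" "range (\<lambda>k. b c ! \<rho> k) \<subseteq> carrier (B c)"
      using cI bc \<rho> nth_mem[of _ c] nth_mem[of _ "b c"] by (auto simp: subset_iff)
    have "same_atomic \<sigma> N (\<lambda>k. c ! \<rho> k) (B c) (\<lambda>k. b c ! \<rho> k)"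
      unfolding same_atomic_def
    proof (intro allI impI)
      fix \<phi> :: "'u fm"
      assume \<phi>: "atomic \<phi>" "wf_fm \<sigma> \<phi>"
      have "\<forall>\<^sub>F a in G. sat (B a) (\<lambda>k. p (c ! \<rho> k) a) \<phi> = sat (B c) (\<lambda>k. b c ! \<rho> k) \<phi>"
        unfolding ev using cI same_atomicD[OF same \<phi>] by (intro exI[of _ "set c"]) blast
      then have "sat N (\<lambda>k. c ! \<rho> k) \<phi> \<longleftrightarrow> (\<forall>\<^sub>F a in G. sat (B c) (\<lambda>k. b c ! \<rho> k) \<phi>)"
        unfolding sat_N[OF ranges(1) \<phi>] by (rule eventually_subst)
      also have "\<dots> \<longleftrightarrow> sat (B c) (\<lambda>k. b c ! \<rho> k) \<phi>"
        unfolding ev using above by blast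
      finally show "sat N (\<lambda>k. c ! \<rho> k) \<phi> = sat (B c) (\<lambda>k. b c ! \<rho> k) \<phi>" .
    qed
    then have "((N, map (\<lambda>k. c ! \<rho> k) [0..<length c]), (B c, map (\<lambda>k. b c ! \<rho> k) [0..<length c]))
        \<in> (type_step (all_strucs \<sigma>))\<^sup>*"
      using ranges N(1,2) B(1)[OF c(1)] \<sigma> by (intro type_steps_if_same_atomic) auto
    moreover have "map (\<lambda>k. c ! \<rho> k) [0..<length c] = c" "map (\<lambda>k. b c ! \<rho> k) [0..<length c] = b c"
      using bc(2) by (auto intro!: nth_equalityI simp: \<rho>_def)
    ultimately have "tp (all_strucs \<sigma>) N c = tp (all_strucs \<sigma>) (B c) (b c)"
      using tp_eq_iff_steps[OF \<sigma>_class, of N c "B c" "b c"] N(1,2) B(1)[OF c(1)] cI bc(1) by auto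
    then show ?thesis
      using B(4)[OF c(1)] by simp
  qed
  have "tp (all_strucs \<sigma>) N c = \<Phi> (tp K I c)" if c: "increasing lt I c" for c
  proof (cases "c = []")
    case True
    \<comment> \<open>If \<open>\<sigma>\<close> has no constants, then the empty tuple generates no structure, and its type is
      obtained by restriction from the type of a single element.\<close>
    obtain x where "x \<in> carrier I"
      using carrier_I(1) by blast
    then have x: "increasing lt I [x]"
      by (simp add: increasing_def)
    have "\<Phi> (tp K I (nths [x] {})) = tp (all_strucs \<sigma>) N (nths [x] {})"
      using tp_nonempty[OF x] N(1,2) \<open>x \<in> carrier I\<close>
      by (intro blueprint_sublist[OF K(1) \<Phi> I x]) auto
    then show ?thesis
      using True by simp
  qed (use tp_nonempty c in blast)
  then have "is_EM K lt \<sigma> \<Phi> I N"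
    using N unfolding is_EM_def by blast
  then show ?thesis
    by blast
qed

text \<open>
  Finitely many elements of \<open>EM(I, \<Phi>)\<close> are values of terms at a single increasing tuple \<open>a\<close>, and
  the values of the same terms at a realization of \<open>\<Phi>(tp(a))\<close> satisfy the same atomic formulas.
\<close>

lemma EM_finitely_realized:
  assumes K: "abstract_class K" "ordered_class K lt" and \<Phi>: "blueprint K lt \<sigma> \<Phi>"
    and real: "\<And>p. p \<in> S_inc K lt \<Longrightarrow> \<exists>B\<in>S. \<exists>b. is_struc \<sigma> B \<and> set b \<subseteq> carrier B \<and>
      \<Phi> p = tp (all_strucs \<sigma>) B b"
    and I: "I \<in> members K" and N: "is_EM K lt \<sigma> \<Phi> I N"
  shows "finitely_realized \<sigma> N S"
  unfolding finitely_realized_def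
proof (intro allI impI)
  fix v :: "nat \<Rightarrow> 'a"
  assume v: "range v \<subseteq> carrier N" and fin: "finite (range v)"
  have \<sigma>: "is_lang \<sigma>"
    using \<Phi> by (simp add: blueprint_def)
  have NI: "is_struc \<sigma> N" "carrier I \<subseteq> carrier N"
    using N by (auto simp: is_EM_def)
  have "\<forall>x. \<exists>t u. x \<in> carrier N \<longrightarrow> wf_trm \<sigma> t \<and> range u \<subseteq> carrier I \<and> x = eval_trm N u t"
    using N unfolding is_EM_def by blast
  then obtain t u where tu: "\<And>x. x \<in> carrier N \<Longrightarrow>
      wf_trm \<sigma> (t x) \<and> range (u x) \<subseteq> carrier I \<and> x = eval_trm N (u x) (t x)"
    by metis
  obtain x0 where x0: "x0 \<in> carrier I"
    using abstract_classD(1)[OF K(1) I] unfolding is_struc_def by blast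
  define X where "X = insert x0 (\<Union>x\<in>range v. u x ` fv_trm (t x))"
  have "u x k \<in> carrier I" if "x \<in> range v" for x k
    using that v tu range_subsetD by (metis subset_iff)
  then have "X \<subseteq> carrier I"
    using x0 unfolding X_def by auto
  moreover have "finite X"
    unfolding X_def by (intro finite.insertI finite_UN_I fin finite_imageI finite_fv_trm)
  ultimately obtain a where a: "increasing lt I a" "set a = X"
    using increasing_enumeration[OF K(2) I] by blast
  have aI: "set a \<subseteq> carrier I" and ne: "a \<noteq> []"
    using a by (auto simp: increasing_def X_def)
  obtain B b where B: "B \<in> S" "is_struc \<sigma> B" "set b \<subseteq> carrier B" "\<Phi> (tp K I a) = tp (all_strucs \<sigma>) B b"
    using real[OF tp_in_S_inc_all[OF I a(1)]] by blast
  define \<rho> where "\<rho> k = (if k < length a then k else 0)" for k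
  have \<rho>: "\<rho> k < length a" for k
    using ne by (simp add: \<rho>_def)
  have len: "length b = length a"
    by (rule blueprint_length[OF \<Phi> I a(1) B(4,2,3)])
  have "tp (all_strucs \<sigma>) N a = tp (all_strucs \<sigma>) B b"
    using N a(1) B(4) by (simp add: is_EM_def)
  then have "((N, a), (B, b)) \<in> (type_step (all_strucs \<sigma>))\<^sup>*"
    using tp_eq_iff_steps[OF abstract_class_all_strucs[OF \<sigma>], of N a B b] NI aI B(2,3) by auto
  then have same: "same_atomic \<sigma> N (\<lambda>k. a ! \<rho> k) B (\<lambda>k. b ! \<rho> k)"
    by (rule same_atomic_if_type_steps) (rule \<rho>)
  have "\<forall>y. \<exists>j. y \<in> X \<longrightarrow> a ! \<rho> j = y"
    using a(2) by (metis \<rho>_def in_set_conv_nth)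
  then obtain idx where idx: "\<And>y. y \<in> X \<Longrightarrow> a ! \<rho> (idx y) = y"
    by metis
  define s where "s k = subst_trm (\<lambda>j. Var (idx (u (v k) j))) (t (v k))" for k
  have vN: "v k \<in> carrier N" for k
    using v by blast
  have s: "wf_trm \<sigma> (s k)" for k
    unfolding s_def using tu[OF vN] by (simp add: wf_subst_trm)
  have "eval_trm N (\<lambda>k. a ! \<rho> k) (s k) = v k" for k
  proof -
    have "u (v k) j \<in> X" if "j \<in> fv_trm (t (v k))" for j
      using that unfolding X_def by blast
    then have "eval_trm N (\<lambda>k. a ! \<rho> k) (s k) = eval_trm N (u (v k)) (t (v k))"
      unfolding s_def eval_subst_trm by (intro eval_trm_cong) (simp add: idx)
    then show ?thesis
      using tu[OF vN[of k]] by (simp only:)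
  qed
  then have "same_atomic \<sigma> N v B (\<lambda>k. eval_trm B (\<lambda>k. b ! \<rho> k) (s k))"
    using same_atomic_subst[OF same s] by simp
  moreover have "range (\<lambda>k. b ! \<rho> k) \<subseteq> carrier B"
    using B(3) \<rho> len nth_mem[of _ b] by (auto simp: subset_iff)
  then have "range (\<lambda>k. eval_trm B (\<lambda>k. b ! \<rho> k) (s k)) \<subseteq> carrier B"
    using eval_trm_in_carrier[OF B(2) _ s] by blast
  ultimately show "\<exists>B\<in>S. \<exists>w. range w \<subseteq> carrier B \<and> same_atomic \<sigma> N v B w"
    using B(1) by blast
qed

section \<open>The Ehrenfeucht-Mostowski blueprint of a PC pair\<close>

lemma expansion_reduct:
  "is_struc L'' N \<Longrightarrow> sublang L L' \<Longrightarrow> sublang L' L'' \<Longrightarrow> expansion L (reduct L N) L' (reduct L' N)"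
  unfolding expansion_def by (simp add: is_struc_reduct reduct_reduct)

theorem theorem4p7:
  fixes K :: "'u abs_class" and lt :: 'u
    and Big :: "'u cardinal \<Rightarrow> 'u struc set" and f :: "'u cardinal \<Rightarrow> 'u cardinal"
    and \<KK> :: "'u struc set" and prec :: "('u struc \<times> 'u struc) set" and \<tau> \<tau>\<^sub>1 :: "'u lang"
    and M I :: "'u cardinal \<Rightarrow> 'u struc" and F :: "'u cardinal \<Rightarrow> 'u \<Rightarrow> 'u"
  assumes "uncountable (UNIV :: 'u set)"
    and "cofinal_ER_class K lt Big f"
    and "PC_pair \<tau> \<KK> prec \<tau>\<^sub>1"
    and "\<And>\<alpha>. \<alpha> < f (lang_card \<tau>\<^sub>1) \<Longrightarrow>
           M \<alpha> \<in> \<KK> \<and> I \<alpha> \<in> Big \<alpha> \<and>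
           inj_on (F \<alpha>) (carrier (I \<alpha>)) \<and> F \<alpha> ` carrier (I \<alpha>) \<subseteq> carrier (M \<alpha>)"
  shows "\<exists>\<sigma> \<Phi>. (\<sigma>, \<Phi>) \<in> Upsilon K lt \<tau> (lang_card \<tau>\<^sub>1) \<KK> prec \<and>
           (\<forall>p\<in>S_inc K lt. cofinally_many_below (f (lang_card \<tau>\<^sub>1)) (\<lambda>\<alpha>.
              \<exists>i. increasing lt (I \<alpha>) i \<and> tp K (I \<alpha>) i = p \<and>
                  tp (all_strucs \<tau>) (M \<alpha>) (map (F \<alpha>) i) = type_reduct \<tau> (\<Phi> p)))"
proof -
  let ?\<mu> = "lang_card \<tau>\<^sub>1" and ?\<chi> = "f (lang_card \<tau>\<^sub>1)"
  have \<tau>: "is_lang \<tau>" and \<tau>\<^sub>1: "is_lang \<tau>\<^sub>1" and \<tau>\<tau>\<^sub>1: "sublang \<tau> \<tau>\<^sub>1"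
    and \<KK>: "\<And>M. M \<in> \<KK> \<Longrightarrow> is_struc \<tau> M"
    using assms(3) by (simp_all add: PC_pair_def)
  obtain T \<Gamma> where T: "is_theory \<tau>\<^sub>1 T" and \<Gamma>: "\<forall>q\<in>\<Gamma>. is_syntactic_type \<tau>\<^sub>1 q"
    and PC_all: "\<forall>M. is_struc \<tau> M \<longrightarrow> (M \<in> \<KK> \<longleftrightarrow>
      (\<exists>M\<^sub>1. expansion \<tau> M \<tau>\<^sub>1 M\<^sub>1 \<and> models M\<^sub>1 T \<and> (\<forall>q\<in>\<Gamma>. omits M\<^sub>1 q)))"
    and PC_prec_all: "\<forall>M\<in>\<KK>. \<forall>N\<in>\<KK>. (M, N) \<in> prec \<longleftrightarrow>
      (\<exists>M\<^sub>1 N\<^sub>1. expansion \<tau> M \<tau>\<^sub>1 M\<^sub>1 \<and> models M\<^sub>1 T \<and> (\<forall>q\<in>\<Gamma>. omits M\<^sub>1 q) \<and>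
        expansion \<tau> N \<tau>\<^sub>1 N\<^sub>1 \<and> models N\<^sub>1 T \<and> (\<forall>q\<in>\<Gamma>. omits N\<^sub>1 q) \<and> substruc \<tau>\<^sub>1 M\<^sub>1 N\<^sub>1)"
    using assms(3) unfolding PC_pair_def by (elim conjE exE) (rule that)
  note PC = PC_all[rule_format] and PC_prec = PC_prec_all[rule_format]
  have K: "abstract_class K" "ordered_class K lt" and Big: "bigness_notion K Big"
    using assms(2) by (simp_all add: cofinal_ER_class_def)
  have I_mem: "I \<alpha> \<in> members K" if "\<alpha> < ?\<chi>" for \<alpha>
    using assms(4)[OF that] Big unfolding bigness_notion_def by blast

  obtain sk where sk: "skolem_names \<tau>\<^sub>1 sk" and \<sigma>: "is_lang (skolem_lang \<tau>\<^sub>1 sk)"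
    and card_\<sigma>: "lang_card (skolem_lang \<tau>\<^sub>1 sk) \<le> ?\<mu>"
    using skolem_names_exist[OF assms(1) \<tau>\<^sub>1] by blast
  define \<sigma> where "\<sigma> = skolem_lang \<tau>\<^sub>1 sk"
  have \<tau>\<^sub>1\<sigma>: "sublang \<tau>\<^sub>1 \<sigma>"
    by (simp add: \<sigma>_def sublang_skolem_lang)
  then have \<tau>\<sigma>: "sublang \<tau> \<sigma>"
    by (rule sublang_trans[OF \<tau>\<tau>\<^sub>1])

  \<comment> \<open>The Skolemized expansions of the given structures.\<close>
  have "\<exists>B. is_struc \<sigma> B \<and> has_skolem_functions \<tau>\<^sub>1 sk B \<and> reduct \<tau> B = M \<alpha> \<and>
      models (reduct \<tau>\<^sub>1 B) T \<and> (\<forall>q\<in>\<Gamma>. omits (reduct \<tau>\<^sub>1 B) q)" if \<alpha>: "\<alpha> < ?\<chi>" for \<alpha>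
  proof -
    have "M \<alpha> \<in> \<KK>"
      using assms(4)[OF \<alpha>] by blast
    then obtain M\<^sub>1 where M\<^sub>1: "expansion \<tau> (M \<alpha>) \<tau>\<^sub>1 M\<^sub>1" "models M\<^sub>1 T" "\<forall>q\<in>\<Gamma>. omits M\<^sub>1 q"
      using PC[OF \<KK>] by blast
    then have "is_struc \<tau>\<^sub>1 M\<^sub>1"
      by (simp add: expansion_def)
    then obtain B where "expansion \<tau>\<^sub>1 M\<^sub>1 \<sigma> B" "has_skolem_functions \<tau>\<^sub>1 sk B"
      using skolem_expansion_exists[OF _ sk] unfolding \<sigma>_def by blast
    moreover from this(1) have "is_struc \<sigma> B" "reduct \<tau>\<^sub>1 B = M\<^sub>1"
      by (simp_all add: expansion_def)
    moreover from this(2) have "reduct \<tau> B = M \<alpha>"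
      using M\<^sub>1(1) reduct_reduct[OF \<tau>\<tau>\<^sub>1, of B] by (simp add: expansion_def)
    ultimately show ?thesis
      using M\<^sub>1(2,3) by auto
  qed
  then obtain B where B: "\<And>\<alpha>. \<alpha> < ?\<chi> \<Longrightarrow> is_struc \<sigma> (B \<alpha>)"
    "\<And>\<alpha>. \<alpha> < ?\<chi> \<Longrightarrow> has_skolem_functions \<tau>\<^sub>1 sk (B \<alpha>)"
    "\<And>\<alpha>. \<alpha> < ?\<chi> \<Longrightarrow> reduct \<tau> (B \<alpha>) = M \<alpha>"
    "\<And>\<alpha>. \<alpha> < ?\<chi> \<Longrightarrow> models (reduct \<tau>\<^sub>1 (B \<alpha>)) T"
    "\<And>\<alpha> q. \<alpha> < ?\<chi> \<Longrightarrow> q \<in> \<Gamma> \<Longrightarrow> omits (reduct \<tau>\<^sub>1 (B \<alpha>)) q"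
    by metis
  have carrier_B: "carrier (B \<alpha>) = carrier (M \<alpha>)" if "\<alpha> < ?\<chi>" for \<alpha>
    using B(3)[OF that] by (metis carrier_reduct)

  have ER: "(\<forall>\<alpha><f \<mu>. is_struc \<sigma> (M \<alpha>) \<and> I \<alpha> \<in> Big \<alpha> \<and>
           inj_on (F \<alpha>) (carrier (I \<alpha>)) \<and> F \<alpha> ` carrier (I \<alpha>) \<subseteq> carrier (M \<alpha>)) \<Longrightarrow>
        \<exists>\<Phi>. blueprint K lt \<sigma> \<Phi> \<and>
           (\<forall>p\<in>S_inc K lt. cofinally_many_below (f \<mu>) (\<lambda>\<alpha>.
              \<exists>i. increasing lt (I \<alpha>) i \<and> tp K (I \<alpha>) i = p \<and>
                  tp (all_strucs \<sigma>) (M \<alpha>) (map (F \<alpha>) i) = \<Phi> p))"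
    if "is_lang \<sigma>" "lang_card \<sigma> \<le> \<mu>" for \<mu> \<sigma> M I F
    using assms(2) that by (simp only: cofinal_ER_class_def)
  have "\<exists>\<Phi>. blueprint K lt \<sigma> \<Phi> \<and>
     (\<forall>p\<in>S_inc K lt. cofinally_many_below ?\<chi> (\<lambda>\<alpha>.
        \<exists>i. increasing lt (I \<alpha>) i \<and> tp K (I \<alpha>) i = p \<and>
            tp (all_strucs \<sigma>) (B \<alpha>) (map (F \<alpha>) i) = \<Phi> p))"
    using \<sigma> card_\<sigma> assms(4) B(1) carrier_B unfolding \<sigma>_def[symmetric] by (intro ER) auto
  then obtain \<Phi> where \<Phi>: "blueprint K lt \<sigma> \<Phi>"
    and cof: "\<And>p. p \<in> S_inc K lt \<Longrightarrow> cofinally_many_below ?\<chi> (\<lambda>\<alpha>.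
        \<exists>i. increasing lt (I \<alpha>) i \<and> tp K (I \<alpha>) i = p \<and>
            tp (all_strucs \<sigma>) (B \<alpha>) (map (F \<alpha>) i) = \<Phi> p)"
    by blast

  define S where "S = B ` {\<alpha>. \<alpha> < ?\<chi>}"
  \<comment> \<open>Injectivity of the maps \<open>F \<alpha>\<close> enters here.  It makes the index structures subsets
    of their Ehrenfeucht-Mostowski models.\<close>
  have real: "\<exists>C\<in>S. \<exists>b. is_struc \<sigma> C \<and> set b \<subseteq> carrier C \<and> distinct b \<and>
      \<Phi> p = tp (all_strucs \<sigma>) C b" if p: "p \<in> S_inc K lt" for p
  proof -
    obtain \<alpha> i where \<alpha>: "\<alpha> < ?\<chi>" and i: "increasing lt (I \<alpha>) i"
      "tp (all_strucs \<sigma>) (B \<alpha>) (map (F \<alpha>) i) = \<Phi> p"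
      using cof[OF p] unfolding cofinally_many_below_def by blast
    have iI: "set i \<subseteq> carrier (I \<alpha>)"
      using i(1) by (simp add: increasing_def)
    have "distinct (map (F \<alpha>) i)"
      using increasing_distinct[OF K(2) I_mem[OF \<alpha>] i(1)] assms(4)[OF \<alpha>] iI
      by (auto simp: distinct_map intro: inj_on_subset)
    moreover have "set (map (F \<alpha>) i) \<subseteq> carrier (B \<alpha>)"
      using carrier_B[OF \<alpha>] assms(4)[OF \<alpha>] iI by auto
    moreover have "B \<alpha> \<in> S"
      using \<alpha> by (simp add: S_def)
    ultimately show ?thesis
      using B(1)[OF \<alpha>] i(2) by metis
  qed

  have EM: "expansion \<tau> (reduct \<tau> N) \<tau>\<^sub>1 (reduct \<tau>\<^sub>1 N) \<and> models (reduct \<tau>\<^sub>1 N) T \<and>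
      (\<forall>q\<in>\<Gamma>. omits (reduct \<tau>\<^sub>1 N) q) \<and> reduct \<tau> N \<in> \<KK>"
    if J: "J \<in> members K" and N: "is_EM K lt \<sigma> \<Phi> J N" for J N
  proof -
    have N_struc: "is_struc \<sigma> N"
      using N by (simp add: is_EM_def)
    have fr: "finitely_realized (skolem_lang \<tau>\<^sub>1 sk) N S"
      unfolding \<sigma>_def[symmetric]
    proof (rule EM_finitely_realized[OF K \<Phi> _ J N])
      show "\<exists>C\<in>S. \<exists>b. is_struc \<sigma> C \<and> set b \<subseteq> carrier C \<and> \<Phi> p = tp (all_strucs \<sigma>) C b"
        if "p \<in> S_inc K lt" for p
        using real[OF that] by blast
    qed
    have S: "is_struc (skolem_lang \<tau>\<^sub>1 sk) C \<and> has_skolem_functions \<tau>\<^sub>1 sk C" if "C \<in> S" for C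
      using that B(1,2) unfolding S_def \<sigma>_def by auto
    have "models (reduct \<tau>\<^sub>1 N) T"
      by (rule skolem_transfer_theory[OF N_struc[unfolded \<sigma>_def] S fr T])
        (use B(4) in \<open>auto simp: S_def\<close>)
    moreover have "omits (reduct \<tau>\<^sub>1 N) q" if "q \<in> \<Gamma>" for q
      by (rule skolem_transfer_omits[OF N_struc[unfolded \<sigma>_def] S fr bspec[OF \<Gamma> that]])
        (use B(5)[OF _ that] in \<open>auto simp: S_def\<close>)
    moreover have "expansion \<tau> (reduct \<tau> N) \<tau>\<^sub>1 (reduct \<tau>\<^sub>1 N)"
      by (rule expansion_reduct[OF N_struc \<tau>\<tau>\<^sub>1 \<tau>\<^sub>1\<sigma>])
    ultimately show ?thesis
      using PC[OF is_struc_reduct[OF N_struc \<tau>\<sigma>]] by blast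
  qed
  have exists: "\<exists>N. is_EM K lt \<sigma> \<Phi> J N" if "J \<in> members K" for J
  proof (rule EM_exists[OF assms(1) K \<Phi> _ that])
    show "\<exists>C b. is_struc \<sigma> C \<and> set b \<subseteq> carrier C \<and> distinct b \<and> \<Phi> p = tp (all_strucs \<sigma>) C b"
      if "p \<in> S_inc K lt" for p
      using real[OF that] by blast
  qed
  have prec: "(reduct \<tau> N, reduct \<tau> N') \<in> prec"
    if J: "(J, J') \<in> leq K" and N: "is_EM K lt \<sigma> \<Phi> J N" "is_EM K lt \<sigma> \<Phi> J' N'"
      and sub: "substruc \<sigma> N N'" for J J' N N'
  proof -
    have "J \<in> members K" "J' \<in> members K"
      using abstract_classD(2)[OF K(1) J] by auto
    then show ?thesis
      using EM[OF _ N(1)] EM[OF _ N(2)] PC_prec substruc_reduct[OF sub \<tau>\<^sub>1\<sigma>] by blast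
  qed
  have "(\<sigma>, \<Phi>) \<in> Upsilon K lt \<tau> ?\<mu> \<KK> prec"
    using \<Phi> \<tau>\<sigma> card_\<sigma> exists EM prec unfolding Upsilon_def \<sigma>_def[symmetric] by auto
  moreover have "cofinally_many_below ?\<chi> (\<lambda>\<alpha>. \<exists>i. increasing lt (I \<alpha>) i \<and> tp K (I \<alpha>) i = p \<and>
      tp (all_strucs \<tau>) (M \<alpha>) (map (F \<alpha>) i) = type_reduct \<tau> (\<Phi> p))" if p: "p \<in> S_inc K lt" for p
  proof -
    have red: "tp (all_strucs \<tau>) (M \<alpha>) (map (F \<alpha>) i) = type_reduct \<tau> (\<Phi> p)"
      if \<alpha>: "\<alpha> < ?\<chi>" and i: "increasing lt (I \<alpha>) i"
        "tp (all_strucs \<sigma>) (B \<alpha>) (map (F \<alpha>) i) = \<Phi> p" for \<alpha> i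
    proof -
      have "set (map (F \<alpha>) i) \<subseteq> carrier (B \<alpha>)"
        using i(1) carrier_B[OF \<alpha>] assms(4)[OF \<alpha>] by (auto simp: increasing_def)
      then have "type_reduct \<tau> (tp (all_strucs \<sigma>) (B \<alpha>) (map (F \<alpha>) i)) =
          tp (all_strucs \<tau>) (reduct \<tau> (B \<alpha>)) (map (F \<alpha>) i)"
        using \<tau> \<sigma> \<tau>\<sigma> B(1)[OF \<alpha>] unfolding \<sigma>_def[symmetric] by (intro type_reduct_tp)
      then show ?thesis
        using i(2) B(3)[OF \<alpha>] by simp
    qed
    then show ?thesis
      using cof[OF p] unfolding cofinally_many_below_def by meson
  qed
  ultimately show ?thesis
    by blast
qed

end
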